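(* Let $G$ be a hyperbolic random graph with parameters $n$, $\alpha\in(1/2,1)$ and $C$. With high probability, $G$ is such that for any two vertices $s,t$ of $G$, a shortest path between $s$ and $t$ is computed by the bidirectional BFS with greedy alternation strategy in time $\tilde{\mathcal O}(n^{2-1/\alpha} + n^{1/(2\alpha)} + \delta_{\max})$.
   Context: Hyperbolic random graphs: fix constants $\alpha\in(1/2,1)$ and $C\in\mathbb R$, let $n$ be the number of vertices and $R = 2\log n + C$ (natural logarithm). Each of the $n$ vertices is placed independently at a random point of the disk of radius $R$ around a fixed origin $O$ of the hyperbolic plane, given in polar coordinates $(r,\varphi)$: the angle $\varphi$ is uniform in $[0,2\pi)$ and the radius $r$ has density $\alpha\sinh(\alpha r)/(\cosh(\alpha R)-1)$ on $[0,R]$. The hyperbolic distance $d$ between $(r_1,\varphi_1)$ and $(r_2,\varphi_2)$ is given by $\cosh d = \cosh r_1\cosh r_2 - \sinh r_1\sinh r_2\cos(\Delta)$, where $\Delta = \pi - |\pi - |\varphi_1-\varphi_2||$ is the angular distance. Two vertices are adjacent iff their hyperbolic distance is less than $R$. Asymptotics are as $n\to\infty$ with $\alpha, C$ fixed; "with high probability" means with probability $1-O(1/n)$ over the random choice of $G$; $\tilde{\mathcal O}$ suppresses polylogarithmic factors in $n$; $\delta_{\max}$ is the maximum degree of $G$. Bidirectional BFS: for a vertex $s$, the BFS from $s$ has layers $L^s_0=\{s\}$ and $L^s_{i+1}$ = the neighbors of vertices in $L^s_i$ not contained in earlier layers; computing $L^s_{i+1}$ from $L^s_i$ is an exploration step,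 which explores the $c^s_i := \sum_{v\in L^s_i}\deg(v)$ edges incident to $L^s_i$. The bidirectional BFS runs a forward BFS from $s$ and a backward BFS from $t$, alternating between them only after full exploration steps, and stops once some vertex has been found by both searches (at which point a shortest $s$-$t$ path is known). The greedy alternation strategy: if the latest layers are $L^s_i$ and $L^t_j$, perform the next exploration step in the forward search if $c^s_i \le c^t_j$ and in the backward search otherwise. The running time is proportional to the number of explored edges. *)

theory Defs
  imports
    "HOL-Probability.Probability"
    "HOL-Library.While_Combinator"
    "HOL-Library.Landau_Symbols"
begin

text \<open>Points of the hyperbolic plane are pairs (radius, angle) of polar coordinates.\<close>

definition angular_dist :: "real \<Rightarrow> real \<Rightarrow> real" where
  "angular_dist \<phi>1 \<phi>2 = pi - \<bar>pi - \<bar>\<phi>1 - \<phi>2\<bar>\<bar>"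

definition hyp_dist :: "real \<times> real \<Rightarrow> real \<times> real \<Rightarrow> real" where
  "hyp_dist p q =
     arcosh (cosh (fst p) * cosh (fst q)
             - sinh (fst p) * sinh (fst q) * cos (angular_dist (snd p) (snd q)))"

definition disk_radius :: "real \<Rightarrow> nat \<Rightarrow> real" where
  "disk_radius C n = 2 * ln (real n) + C"

definition radius_measure :: "real \<Rightarrow> real \<Rightarrow> real measure" where
  "radius_measure \<alpha> R =
     density lborel (\<lambda>r. ennreal (\<alpha> * sinh (\<alpha> * r) / (cosh (\<alpha> * R) - 1)) * indicator {0..R} r)"

definition angle_measure :: "real measure" where
  "angle_measure = uniform_measure lborel {0..<2 * pi}"

text \<open>
  The vertices are the numbers below \<open>n\<close>; an outcome assigns to each of them its
  coordinates. This is a probability space only if \<open>disk_radius C n > 0\<close>, which holds for all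
  large \<open>n\<close>.
\<close>

definition hrg_space :: "real \<Rightarrow> real \<Rightarrow> nat \<Rightarrow> (nat \<Rightarrow> real \<times> real) measure" where
  "hrg_space \<alpha> C n =
     Pi\<^sub>M {..<n} (\<lambda>_. radius_measure \<alpha> (disk_radius C n) \<Otimes>\<^sub>M angle_measure)"

definition hrg_edges :: "real \<Rightarrow> nat \<Rightarrow> (nat \<Rightarrow> real \<times> real) \<Rightarrow> (nat \<times> nat) set" where
  "hrg_edges C n \<omega> =
     {(u, v). u < n \<and> v < n \<and> u \<noteq> v \<and> hyp_dist (\<omega> u) (\<omega> v) < disk_radius C n}"

definition degree :: "('a \<times> 'a) set \<Rightarrow> 'a \<Rightarrow> nat" where
  "degree E v = card (E `` {v})"

definition max_degree :: "'a set \<Rightarrow> ('a \<times> 'a) set \<Rightarrow> nat" where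
  "max_degree V E = Max (degree E ` V)"

definition walk :: "('a \<times> 'a) set \<Rightarrow> 'a \<Rightarrow> 'a \<Rightarrow> 'a list \<Rightarrow> bool" where
  "walk E s t p \<longleftrightarrow> p \<noteq> [] \<and> hd p = s \<and> last p = t \<and> successively (\<lambda>u v. (u, v) \<in> E) p"

text \<open>A walk of minimum length never repeats a vertex, so it is a shortest path.\<close>

definition shortest_path :: "('a \<times> 'a) set \<Rightarrow> 'a \<Rightarrow> 'a \<Rightarrow> 'a list \<Rightarrow> bool" where
  "shortest_path E s t p \<longleftrightarrow> walk E s t p \<and> (\<forall>q. walk E s t q \<longrightarrow> length p \<le> length q)"

fun layer :: "('a \<times> 'a) set \<Rightarrow> 'a \<Rightarrow> nat \<Rightarrow> 'a set" where
  "layer E s 0 = {s}"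
| "layer E s (Suc i) = E `` layer E s i - (\<Union>k\<in>{..i}. layer E s k)"

definition layer_cost :: "('a \<times> 'a) set \<Rightarrow> 'a \<Rightarrow> nat \<Rightarrow> nat" where
  "layer_cost E s i = (\<Sum>v\<in>layer E s i. degree E v)"

definition found :: "('a \<times> 'a) set \<Rightarrow> 'a \<Rightarrow> nat \<Rightarrow> 'a set" where
  "found E s i = (\<Union>k\<in>{..i}. layer E s k)"

text \<open>
  Path from the root \<open>s\<close> to \<open>v\<close>, a vertex of layer \<open>i\<close>, in the BFS tree; the parent of a vertex
  is some neighbor in the preceding layer.
\<close>

primrec tree_path :: "('a \<times> 'a) set \<Rightarrow> 'a \<Rightarrow> nat \<Rightarrow> 'a \<Rightarrow> 'a list" where
  "tree_path E s 0 v = [v]"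
| "tree_path E s (Suc i) v =
     tree_path E s i (SOME u. u \<in> layer E s i \<and> (u, v) \<in> E) @ [v]"

text \<open>
  A search state \<open>(i, j, c)\<close> records the indices of the latest forward layer and the latest
  backward layer, and the number of edges explored so far. A strategy decides whether the next
  exploration step is a forward one. The search also stops when the latest layer of
  one of the searches is empty: that search has then exhausted its connected component.
\<close>

type_synonym search_state = "nat \<times> nat \<times> nat"

definition searching :: "('a \<times> 'a) set \<Rightarrow> 'a \<Rightarrow> 'a \<Rightarrow> search_state \<Rightarrow> bool" where
  "searching E s t = (\<lambda>(i, j, c).
     found E s i \<inter> found E t j = {} \<and> layer E s i \<noteq> {} \<and> layer E t j \<noteq> {})"

definition exploration_step ::
    "(nat \<Rightarrow> nat \<Rightarrow> bool) \<Rightarrow> ('a \<times> 'a) set \<Rightarrow> 'a \<Rightarrow> 'a \<Rightarrow> search_state \<Rightarrow> search_state" where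
  "exploration_step strategy E s t = (\<lambda>(i, j, c).
     if strategy i j then (Suc i, j, c + layer_cost E s i)
     else (i, Suc j, c + layer_cost E t j))"

definition greedy :: "('a \<times> 'a) set \<Rightarrow> 'a \<Rightarrow> 'a \<Rightarrow> nat \<Rightarrow> nat \<Rightarrow> bool" where
  "greedy E s t i j \<longleftrightarrow> layer_cost E s i \<le> layer_cost E t j"

text \<open>
  When the searches first meet, every common vertex lies in both latest layers. No path is
  reported if they stop without having met.
\<close>

definition search_result :: "('a \<times> 'a) set \<Rightarrow> 'a \<Rightarrow> 'a \<Rightarrow> nat \<Rightarrow> nat \<Rightarrow> 'a list option" where
  "search_result E s t i j =
     (if found E s i \<inter> found E t j = {} then None
      else let v = (SOME v. v \<in> layer E s i \<inter> layer E t j)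
           in Some (tree_path E s i v @ tl (rev (tree_path E t j v))))"

text \<open>
  The value is the reported path together with the total number of explored edges;
  it is \<open>None\<close> if the search does not terminate.
\<close>

definition bidirectional_bfs ::
    "(nat \<Rightarrow> nat \<Rightarrow> bool) \<Rightarrow> ('a \<times> 'a) set \<Rightarrow> 'a \<Rightarrow> 'a \<Rightarrow> ('a list option \<times> nat) option" where
  "bidirectional_bfs strategy E s t =
     map_option (\<lambda>(i, j, c). (search_result E s t i j, c))
       (while_option (searching E s t) (exploration_step strategy E s t) (0, 0, 0))"

definition correct_result :: "('a \<times> 'a) set \<Rightarrow> 'a \<Rightarrow> 'a \<Rightarrow> 'a list option \<Rightarrow> bool" where
  "correct_result E s t res \<longleftrightarrow>
     (case res of None \<Rightarrow> \<not> (\<exists>p. walk E s t p) | Some p \<Rightarrow> shortest_path E s t p)"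

definition computes_shortest_path_within ::
    "(nat \<Rightarrow> nat \<Rightarrow> bool) \<Rightarrow> ('a \<times> 'a) set \<Rightarrow> 'a \<Rightarrow> 'a \<Rightarrow> real \<Rightarrow> bool" where
  "computes_shortest_path_within strategy E s t b \<longleftrightarrow>
     (\<exists>res c. bidirectional_bfs strategy E s t = Some (res, c)
        \<and> correct_result E s t res \<and> real c \<le> b)"

end

theory Submission
  imports Defs "HOL-Real_Asymp.Real_Asymp"
begin

text \<open>
  Write \<open>\<rho> = R - l0\<close>, where the disk of radius \<open>l0\<close> has expected population of order \<open>ln n\<close>. With
  high probability it contains a vertex \<open>z\<close>, and \<open>z\<close> is adjacent to every inner vertex, that is, to
  every vertex of radius less than \<open>\<rho>\<close>. So once both searches have explored a layer with an inner
  vertex, they have met. Hence at each step one of the two current layers is preceded only by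
  layers of outer vertices; such a layer lies within a narrow sector around its root, its cost is
  bounded by summing degrees over annuli, and the greedy strategy explores the cheaper layer.

  It remains to bound the number of layers polylogarithmically. A vertex at distance at least
  order \<open>ln (ln n)\<close> from the boundary of the disk has a neighbor one level closer to the
  origin, hence a path of length \<open>O(ln n)\<close> to \<open>z\<close>. A path of vertices that are not adjacent to any
  such vertex cannot pass the angle of one, so it is confined to a sector with few vertices.

  All this holds deterministically once polynomially many boxes (radius at most an integer, angle
  in an interval of cells of width \<open>2 * pi / n\<close>) contain about as many vertices as expected;
  Chernoff and union bounds show that this fails with probability at most \<open>8 / n\<close>.
\<close>

section \<open>Bidirectional search\<close>

text \<open>Origin of the three terms: \<rho> is fixed by n * exp (- \<alpha> * \<rho>) being of
  order ln n, so exp (- \<rho>) is n powr (- 1 / \<alpha>) up to logarithms. An edge between outer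
  vertices turns by at most order exp (R / 2 - \<rho>), so the sector swept by outer layers holds
  about n * exp (R / 2 - \<rho>), that is n powr (2 - 1 / \<alpha>), vertices. The term n powr (1 /
  (2 * \<alpha>)) is exp (\<rho> / 2), the typical degree at radius l0. The maximum degree pays for
  the order ln n vertices of the central disk that the cheaper layer may already contain. Both
  bounds on \<alpha> shape the estimates: 1 / 2 < \<alpha> keeps sums of degrees over annuli under
  control, \<alpha> < 1 makes neighbors closer to the origin plentiful. The obstacle to bounding the
  number of layers is that the graph may be disconnected: s or t may lie in a component that does
  not contain z, so distances to z alone do not suffice and long peripheral paths have to be
  excluded by geometry.\<close>

lemma found_0 [simp]: "found E s 0 = {s}"
  by (simp add: found_def)

lemma found_Suc: "found E s (Suc i) = found E s i \<union> layer E s (Suc i)"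
  by (auto simp: found_def atMost_Suc)

lemma found_Suc_image: "found E s (Suc i) = found E s i \<union> E `` layer E s i"
  unfolding found_Suc by (auto simp: found_def)

lemma found_mono: "i \<le> j \<Longrightarrow> found E s i \<subseteq> found E s j"
  unfolding found_def by (intro UN_mono) auto

lemma layer_subset_found: "layer E s i \<subseteq> found E s i"
  by (auto simp: found_def)

lemma found_step: "u \<in> found E s i \<Longrightarrow> (u, v) \<in> E \<Longrightarrow> v \<in> found E s (Suc i)"
proof -
  assume "u \<in> found E s i" and e: "(u, v) \<in> E"
  then obtain k where "k \<le> i" "u \<in> layer E s k"
    by (auto simp: found_def)
  with e have "v \<in> found E s (Suc k)"
    by (auto simp: found_Suc_image)
  with \<open>k \<le> i\<close> show ?thesis
    using found_mono[of "Suc k" "Suc i" E s] by auto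
qed

lemma found_relpow: "u \<in> found E s i \<Longrightarrow> (u, v) \<in> E ^^ m \<Longrightarrow> v \<in> found E s (i + m)"
proof (induction m arbitrary: v)
  case (Suc m)
  then obtain x where "(u, x) \<in> E ^^ m" "(x, v) \<in> E" by auto
  with Suc show ?case using found_step[of x E s "i + m" v] by simp
qed simp

lemma layer_disjoint: "i < j \<Longrightarrow> layer E s i \<inter> layer E s j = {}"
  by (cases j) auto

lemma layer_unique: "v \<in> layer E s i \<Longrightarrow> v \<in> layer E s j \<Longrightarrow> i = j"
  using layer_disjoint[of i j E s] layer_disjoint[of j i E s] by (cases i j rule: linorder_cases) auto

lemma layer_found_le: "v \<in> layer E s i \<Longrightarrow> v \<in> found E s j \<Longrightarrow> i \<le> j"
  unfolding found_def by (metis UN_E atMost_iff layer_unique)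

lemma layer_Suc_pred:
  assumes "v \<in> layer E s (Suc i)"
  obtains u where "u \<in> layer E s i" "(u, v) \<in> E"
  using assms by auto

text \<open>Putting the k-th vertex into layer k makes the path injective and its indices distances
  from the root; the bound on the number of layers rests on both.\<close>

lemma layer_path:
  assumes "v \<in> layer E s i"
  shows "\<exists>f. f i = v \<and> (\<forall>k\<le>i. f k \<in> layer E s k) \<and> (\<forall>k<i. (f k, f (Suc k)) \<in> E)"
  using assms
proof (induction i arbitrary: v)
  case 0
  then show ?case by auto
next
  case (Suc i)
  from Suc.prems obtain u where u: "u \<in> layer E s i" "(u, v) \<in> E" by (rule layer_Suc_pred)
  from Suc.IH[OF u(1)] obtain f where f: "f i = u" "\<forall>k\<le>i. f k \<in> layer E s k"
    "\<forall>k<i. (f k, f (Suc k)) \<in> E" by auto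
  let ?g = "f(Suc i := v)"
  have "\<forall>k<Suc i. (?g k, ?g (Suc k)) \<in> E"
    using f u by (auto simp: less_Suc_eq)
  moreover have "\<forall>k\<le>Suc i. ?g k \<in> layer E s k"
    using f(2) Suc.prems by (auto simp: le_Suc_eq simp del: layer.simps)
  ultimately show ?case by (intro exI[of _ ?g]) auto
qed

lemma found_closed:
  assumes "layer E s i = {}" "u \<in> found E s i" "(u, v) \<in> E"
  shows "v \<in> found E s i"
  using found_step[OF assms(2,3)] found_Suc_image[of E s i] assms(1) by simp

lemma tree_path_walk:
  assumes "v \<in> layer E s i"
  shows "walk E s v (tree_path E s i v) \<and> length (tree_path E s i v) = Suc i"
  using assms
proof (induction i arbitrary: v)
  case 0
  then show ?case by (auto simp: walk_def)
next
  case (Suc i)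
  define u where "u = (SOME u. u \<in> layer E s i \<and> (u, v) \<in> E)"
  have u: "u \<in> layer E s i \<and> (u, v) \<in> E"
    unfolding u_def by (rule someI_ex) (use Suc.prems in auto)
  with Suc.IH have "walk E s u (tree_path E s i u)" "length (tree_path E s i u) = Suc i"
    by auto
  with u show ?case
    by (auto simp: walk_def successively_append_iff simp flip: u_def)
qed

lemma walk_relpow:
  assumes "walk E s t p"
  shows "(s, t) \<in> E ^^ (length p - 1)"
proof -
  have "p \<noteq> [] \<Longrightarrow> successively (\<lambda>u v. (u, v) \<in> E) p \<Longrightarrow> (hd p, last p) \<in> E ^^ (length p - 1)"
  proof (induction p rule: induct_list012)
    case (3 x y zs)
    then have "(y, last (y # zs)) \<in> E ^^ length zs" "(x, y) \<in> E" by auto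
    then have "(x, last (y # zs)) \<in> E ^^ Suc (length zs)" by (rule relpow_Suc_I2[rotated])
    then show ?case by (simp del: relpow.simps)
  qed auto
  with assms show ?thesis by (auto simp: walk_def)
qed

lemma relpow_found: "(s, v) \<in> E ^^ m \<Longrightarrow> v \<in> found E s m"
  using found_relpow[of s E s 0 v m] by simp

lemma relpow_sym: "sym E \<Longrightarrow> (u, v) \<in> E ^^ m \<Longrightarrow> (v, u) \<in> E ^^ m"
proof (induction m arbitrary: u v)
  case (Suc m)
  then obtain x where "(u, x) \<in> E ^^ m" "(x, v) \<in> E" by auto
  with Suc show ?case by (meson relpow_Suc_I2 symD)
qed simp

text \<open>Cut the walk after \<open>min i m\<close> steps. If m were at most i + j, the cut vertex
  would have been found by both searches.\<close>

lemma found_separated: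
  assumes "sym E" "found E s i \<inter> found E t j = {}" "(s, t) \<in> E ^^ m"
  shows "i + j < m"
proof (rule ccontr)
  assume m: "\<not> i + j < m"
  define a where "a = min i m"
  have "(s, t) \<in> E ^^ (a + (m - a))" using assms(3) by (simp add: a_def)
  then obtain x where x: "(s, x) \<in> E ^^ a" "(x, t) \<in> E ^^ (m - a)"
    by (auto simp: relpow_add)
  have "x \<in> found E s a" "x \<in> found E t (m - a)"
    by (rule relpow_found[OF x(1)], rule relpow_found[OF relpow_sym[OF assms(1) x(2)]])
  moreover have "a \<le> i" "m - a \<le> j" using m by (auto simp: a_def)
  ultimately show False
    using assms(2) found_mono[of a i E s] found_mono[of "m - a" j E t] by auto
qed

section \<open>Invariant, correctness and cost of the bidirectional search\<close>

text \<open>The first conjunct makes every meeting point optimal, as the two tree paths have i + j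
  edges together. The second justifies that \<open>search_result\<close> picks a vertex common to
  the two latest layers.\<close>

definition search_inv :: "('a \<times> 'a) set \<Rightarrow> 'a \<Rightarrow> 'a \<Rightarrow> nat \<Rightarrow> nat \<Rightarrow> bool" where
  "search_inv E s t i j \<longleftrightarrow>
     (\<forall>m. (s, t) \<in> E ^^ m \<longrightarrow> i + j \<le> m) \<and>
     found E s i \<inter> found E t j \<subseteq> layer E s i \<inter> layer E t j"

text \<open>A common vertex v is new on the forward side. Were it in an earlier layer of t, its
  predecessor, already found from s, would also have been found from t, so the searches would have
  met before.\<close>

lemma found_inter_step:
  assumes "sym E" "found E s i \<inter> found E t j = {}"
  shows "found E s (Suc i) \<inter> found E t j \<subseteq> layer E s (Suc i) \<inter> layer E t j"
proof
  fix v assume v: "v \<in> found E s (Suc i) \<inter> found E t j"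
  then have l: "v \<in> layer E s (Suc i)" using assms(2) by (auto simp: found_Suc)
  then obtain u where u: "u \<in> layer E s i" "(u, v) \<in> E" by (rule layer_Suc_pred)
  have "v \<in> layer E t j"
  proof (rule ccontr)
    assume "v \<notin> layer E t j"
    with v obtain k where "k < j" "v \<in> layer E t k"
      by (auto simp: found_def order_le_less)
    then have "u \<in> found E t (Suc k)"
      using u assms(1) found_step[of v E t k u] layer_subset_found by (metis subsetD symD)
    with \<open>k < j\<close> have "u \<in> found E t j" using found_mono[of "Suc k" j E t] by auto
    with u assms(2) layer_subset_found[of E s i] show False by auto
  qed
  with l show "v \<in> layer E s (Suc i) \<inter> layer E t j" by simp
qed

lemma search_inv_step:
  assumes "sym E" "found E s i \<inter> found E t j = {}"
  shows "search_inv E s t (Suc i) j" "search_inv E s t i (Suc j)"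
  using found_separated[OF assms] found_inter_step[OF assms]
    found_inter_step[of E t j s i] assms
  by (fastforce simp: search_inv_def Suc_le_eq Int_commute)+

text \<open>If the searches stop apart, one of them has an empty latest layer; its found set is
  closed under edges and would contain the other root if a walk existed. If they meet, the joined
  walk has i + j edges, which is the lower bound in the invariant.\<close>

lemma search_result_correct:
  assumes "sym E" "search_inv E s t i j"
    and "found E s i \<inter> found E t j \<noteq> {} \<or> layer E s i = {} \<or> layer E t j = {}"
  shows "correct_result E s t (search_result E s t i j)"
proof (cases "found E s i \<inter> found E t j = {}")
  case True
  have "\<not> walk E s t p" for p
  proof
    assume "walk E s t p"
    from walk_relpow[OF this] obtain m where m: "(s, t) \<in> E ^^ m" ..
    have closed: "(x, y) \<in> E ^^ k \<Longrightarrow> layer E x i = {} \<Longrightarrow> y \<in> found E x i" for x y k i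
    proof (induction k arbitrary: y)
      case (Suc k)
      then show ?case by (auto intro: found_closed)
    qed (use found_mono[of 0 i E x] in auto)
    have "s \<in> found E s i" "t \<in> found E t j"
      using found_mono[of 0 i E s] found_mono[of 0 j E t] by auto
    with closed[OF m, of i] closed[OF relpow_sym[OF assms(1) m], of j] assms(3) True
    show False by auto
  qed
  with True show ?thesis by (simp add: correct_result_def search_result_def)
next
  case False
  define v where "v = (SOME v. v \<in> layer E s i \<inter> layer E t j)"
  have "v \<in> layer E s i \<inter> layer E t j"
    unfolding v_def by (rule someI_ex) (use False assms(2) in \<open>auto simp: search_inv_def\<close>)
  then have p: "walk E s v (tree_path E s i v)" "length (tree_path E s i v) = Suc i"
    and q: "walk E t v (tree_path E t j v)" "length (tree_path E t j v) = Suc j"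
    using tree_path_walk[of v E s i] tree_path_walk[of v E t j] by auto
  let ?p = "tree_path E s i v" and ?q = "rev (tree_path E t j v)"
  have q': "walk E v t ?q" using q(1) assms(1)
    by (auto simp: walk_def hd_rev last_rev successively_rev elim: successively_mono dest: symD)
  have "walk E s t (?p @ tl ?q)"
  proof -
    obtain r where r: "?q = v # r" using q' by (cases ?q) (auto simp: walk_def)
    show ?thesis
      using p q' by (auto simp: r walk_def successively_append_iff successively_Cons split: if_splits)
  qed
  moreover have "length (?p @ tl ?q) \<le> length q'" if "walk E s t q'" for q'
  proof -
    have "i + j \<le> length q' - 1"
      using walk_relpow[OF that] assms(2) by (auto simp: search_inv_def)
    moreover have "q' \<noteq> []" using that by (simp add: walk_def)
    then have "length q' \<ge> 1" by (cases q') auto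
    ultimately show ?thesis using p q by simp
  qed
  ultimately have "shortest_path E s t (?p @ tl ?q)" by (simp add: shortest_path_def)
  with False show ?thesis
    by (simp add: correct_result_def search_result_def Let_def v_def)
qed

text \<open>The greedy rule pays the smaller of the two current costs, so only this minimum has to
  be bounded. Each step starts with both indices at most D, so there are at most 2 * D + 1
  steps.\<close>

lemma greedy_search_cost:
  assumes "sym E"
    and depth: "\<And>i. layer E s i \<noteq> {} \<Longrightarrow> i \<le> D" "\<And>j. layer E t j \<noteq> {} \<Longrightarrow> j \<le> D"
    and cheap: "\<And>i j. layer E s i \<noteq> {} \<Longrightarrow> layer E t j \<noteq> {} \<Longrightarrow> found E s i \<inter> found E t j = {} \<Longrightarrow>
       real (min (layer_cost E s i) (layer_cost E t j)) \<le> B"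
    and "B \<ge> 0" "real (2 * D + 1) * B \<le> b"
  shows "computes_shortest_path_within (greedy E s t) E s t b"
proof -
  let ?b = "searching E s t" and ?c = "exploration_step (greedy E s t) E s t"
  let ?P = "\<lambda>(i, j, c). search_inv E s t i j \<and> i + j \<le> 2 * D + 1 \<and> real c \<le> real (i + j) * B"
  have step: "?P (?c x) \<and> 2 * D + 1 - (fst (?c x) + fst (snd (?c x))) < 2 * D + 1 - (fst x + fst (snd x))"
    if "?P x" "?b x" for x
  proof -
    obtain i j c where x: "x = (i, j, c)" by (cases x) auto
    have *: "found E s i \<inter> found E t j = {}" "layer E s i \<noteq> {}" "layer E t j \<noteq> {}"
      using that(2) by (auto simp: searching_def x)
    have "i \<le> D" "j \<le> D" using depth * by auto
    moreover have "real c \<le> real (i + j) * B" using that(1) by (simp add: x)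
    ultimately show ?thesis
      using search_inv_step[OF assms(1) *(1)] cheap[OF *(2,3,1)]
      by (auto simp: x exploration_step_def greedy_def min_def algebra_simps split: if_splits)
  qed
  have init: "?P (0, 0, 0)" by (auto simp: search_inv_def)
  obtain x where x: "while_option ?b ?c (0, 0, 0) = Some x"
    by (rule exE[OF measure_while_option_Some[of ?P ?b ?c "\<lambda>x. 2 * D + 1 - (fst x + fst (snd x))", OF step init]])
  have P: "?P x" by (rule while_option_rule[of ?P ?b ?c, OF _ x init], drule (1) step) simp
  have nb: "\<not> ?b x" using while_option_stop[OF x] .
  obtain i j c where ijc: "x = (i, j, c)" by (cases x) auto
  have "correct_result E s t (search_result E s t i j)"
    using search_result_correct[OF assms(1)] P nb by (auto simp: ijc searching_def)
  moreover have "real c \<le> b"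
  proof -
    have "real c \<le> real (i + j) * B" using P by (simp add: ijc)
    also have "\<dots> \<le> real (2 * D + 1) * B"
      using P \<open>B \<ge> 0\<close> by (intro mult_right_mono) (auto simp: ijc)
    finally show ?thesis using assms by simp
  qed
  ultimately show ?thesis
    by (auto simp: computes_shortest_path_within_def bidirectional_bfs_def x ijc)
qed

section \<open>Adjacency in the hyperbolic disk\<close>

text \<open>The hyperbolic cosine of the distance: by monotonicity adjacency can be decided on it,
  without \<open>arcosh\<close>.\<close>

definition hyp_cosh :: "real \<times> real \<Rightarrow> real \<times> real \<Rightarrow> real" where
  "hyp_cosh p q = cosh (fst p) * cosh (fst q)
     - sinh (fst p) * sinh (fst q) * cos (angular_dist (snd p) (snd q))"

text \<open>Separates the radial part from the angular part; for nonnegative radii the second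
  summand is nonnegative.\<close>

lemma hyp_cosh_alt:
  "hyp_cosh p q = cosh (fst p - fst q)
     + sinh (fst p) * sinh (fst q) * (1 - cos (angular_dist (snd p) (snd q)))"
  by (simp add: hyp_cosh_def cosh_diff algebra_simps)

lemma hyp_cosh_ge_1:
  assumes "0 \<le> fst p" "0 \<le> fst q"
  shows "1 \<le> hyp_cosh p q"
  unfolding hyp_cosh_alt using cosh_real_ge_1[of "fst p - fst q"] assms
  by (smt (verit) cos_le_one mult_nonneg_nonneg sinh_real_nonneg_iff)

lemma hyp_dist_less_iff:
  assumes "0 \<le> fst p" "0 \<le> fst q" "0 \<le> R"
  shows "hyp_dist p q < R \<longleftrightarrow> hyp_cosh p q < cosh R"
proof -
  have "hyp_dist p q = arcosh (hyp_cosh p q)"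
    by (simp add: hyp_dist_def hyp_cosh_def)
  moreover have "R = arcosh (cosh R)" using assms arcosh_cosh_real by simp
  ultimately show ?thesis
    using arcosh_less_iff_real[of "hyp_cosh p q" "cosh R"] hyp_cosh_ge_1[OF assms(1,2)]
      cosh_real_ge_1[of R] by metis
qed

lemma angular_dist_commute: "angular_dist a b = angular_dist b a"
  by (simp add: angular_dist_def abs_minus_commute)

lemma hyp_dist_commute: "hyp_dist p q = hyp_dist q p"
  unfolding hyp_dist_def angular_dist_commute[of "snd p"] by (simp add: mult_ac)

abbreviation "circle_angles \<equiv> {0..<2 * pi}"

lemma angular_dist_bounds:
  assumes "a \<in> circle_angles" "b \<in> circle_angles"
  shows "0 \<le> angular_dist a b" "angular_dist a b \<le> pi" "angular_dist a b \<le> \<bar>a - b\<bar>"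
  using assms by (auto simp: angular_dist_def)

lemma angular_dist_triangle:
  assumes "a \<in> circle_angles" "b \<in> circle_angles" "c \<in> circle_angles"
  shows "angular_dist a c \<le> angular_dist a b + angular_dist b c"
  using assms unfolding angular_dist_def by (auto simp: abs_if)

text \<open>The shorter way from a to c leaves the arc from b to b' through one of its ends.\<close>

lemma angular_dist_crossing:
  assumes "a \<in> circle_angles" "c \<in> circle_angles" "b \<in> circle_angles" "b' \<in> circle_angles"
    and "b \<le> a" "a \<le> b'" "\<not> (b \<le> c \<and> c \<le> b')"
  shows "angular_dist a b \<le> angular_dist a c \<or> angular_dist a b' \<le> angular_dist a c"
  using assms unfolding angular_dist_def by (auto simp: abs_if)

text \<open>The sine is at least x - x^3 / 6, and x^3 <= 4 * x on this range, which covers the half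
  angles up to pi / 2.\<close>

lemma sin_ge_third:
  assumes "0 \<le> x" "x \<le> (2::real)"
  shows "x / 3 \<le> sin x"
proof -
  have "\<bar>sin x - (\<Sum>m<3. sin_coeff m * x ^ m)\<bar> \<le> inverse (fact 3) * \<bar>x\<bar> ^ 3"
    by (rule Maclaurin_sin_bound)
  moreover have "(\<Sum>m<3. sin_coeff m * x ^ m) = x"
    by (simp add: sin_coeff_def numeral_3_eq_3)
  ultimately have "x - x ^ 3 / 6 \<le> sin x"
    using assms by (simp add: fact_numeral field_simps abs_if split: if_splits)
  moreover have "x * x\<^sup>2 \<le> x * 2\<^sup>2"
    using assms by (intro mult_left_mono power_mono) auto
  ultimately show ?thesis by (simp add: power3_eq_cube power2_eq_square)
qed

lemma one_minus_cos_bounds: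
  assumes "0 \<le> t" "t \<le> pi"
  shows "t\<^sup>2 / 18 \<le> 1 - cos t" "1 - cos t \<le> t\<^sup>2 / 2"
proof -
  have eq: "1 - cos t = 2 * (sin (t / 2))\<^sup>2"
    using cos_double_sin[of "t / 2"] by simp
  have "0 \<le> t / 2" "t / 2 \<le> 2" using assms pi_less_4 by auto
  then have s: "t / 2 / 3 \<le> sin (t / 2)" "sin (t / 2) \<le> t / 2"
    using sin_ge_third[of "t / 2"] sin_x_le_x[of "t / 2"] by auto
  have "(t / 6)\<^sup>2 \<le> (sin (t / 2))\<^sup>2" using s assms by (intro power_mono) auto
  then show "t\<^sup>2 / 18 \<le> 1 - cos t" unfolding eq by (simp add: power2_eq_square)
  have "(sin (t / 2))\<^sup>2 \<le> (t / 2)\<^sup>2" using s assms by (intro power_mono) auto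
  then show "1 - cos t \<le> t\<^sup>2 / 2" unfolding eq by (simp add: power2_eq_square)
qed

lemma sinh_ge_quarter_exp: "1 \<le> x \<Longrightarrow> exp x / 4 \<le> sinh (x::real)"
proof -
  assume "1 \<le> x"
  then have "2 \<le> exp x" using exp_ge_add_one_self[of x] by linarith
  then have "inverse (exp x) \<le> exp x / 2"
    by (smt (verit) field_sum_of_halves inverse_eq_divide le_divide_eq_1 divide_le_eq mult_left_mono)
  then show ?thesis by (simp add: sinh_field_def exp_minus)
qed

lemma cosh_le_exp: "0 \<le> x \<Longrightarrow> cosh (x::real) \<le> exp x"
  by (simp add: cosh_field_def)

text \<open>Adjacency puts sinh r1 * sinh r2 * (1 - cos t) below exp R. With the lower bounds exp r
  / 4 and t^2 / 18 this gives the factor 16 * 18 = 288, just below 17^2.\<close>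

lemma angular_dist_adjacent:
  assumes "fst p \<in> {0..R}" "fst q \<in> {0..R}" "snd p \<in> circle_angles" "snd q \<in> circle_angles"
    and "0 \<le> R" "hyp_cosh p q < cosh R"
  shows "angular_dist (snd p) (snd q) \<le> 17 * exp ((R - fst p - fst q) / 2)"
proof -
  let ?t = "angular_dist (snd p) (snd q)"
  have t: "0 \<le> ?t" "?t \<le> pi" using angular_dist_bounds assms by auto
  show ?thesis
  proof (cases "fst p < 1 \<or> fst q < 1")
    \<comment> \<open>Near the origin exp r / 4 may exceed sinh r, but there the claimed bound is at
      least 17 / 2 and hence above pi.\<close>
    case True
    then have "- 1 \<le> (R - fst p - fst q) / 2 * 2" using assms by auto
    then have "1 / 2 \<le> exp ((R - fst p - fst q) / 2)"
      using exp_ge_add_one_self[of "(R - fst p - fst q) / 2"] by linarith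
    with t pi_less_4 show ?thesis by linarith
  next
    case False
    have "exp (fst p) / 4 * (exp (fst q) / 4) * (?t\<^sup>2 / 18)
        \<le> sinh (fst p) * sinh (fst q) * (1 - cos ?t)"
      using False sinh_ge_quarter_exp[of "fst p"] sinh_ge_quarter_exp[of "fst q"]
        one_minus_cos_bounds(1)[OF t] assms by (intro mult_mono) auto
    also have "\<dots> \<le> exp R"
      using assms cosh_le_exp[of R] cosh_real_ge_1[of "fst p - fst q"] unfolding hyp_cosh_alt by linarith
    finally have "?t\<^sup>2 * (exp (fst p) * exp (fst q)) \<le> 288 * exp R" by (simp add: mult_ac)
    then have "?t\<^sup>2 \<le> 288 * exp (R - fst p - fst q)"
      by (simp add: exp_diff exp_add field_simps)
    also have "\<dots> \<le> (17 * exp ((R - fst p - fst q) / 2))\<^sup>2"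
    proof -
      have "exp x = (exp (x / 2))\<^sup>2" for x :: real by (simp flip: exp_double)
      from this[of "R - fst p - fst q"] show ?thesis by (simp add: power_mult_distrib)
    qed
    finally show ?thesis by (rule power2_le_imp_le) simp
  qed
qed

text \<open>The triangle inequality through the origin; opposite angles are the worst case.\<close>

lemma hyp_cosh_adjacent_center:
  assumes "0 \<le> fst p" "0 \<le> fst q" "fst p + fst q < R"
  shows "hyp_cosh p q < cosh R"
proof -
  have "sinh (fst p) * sinh (fst q) * (- 1) \<le> sinh (fst p) * sinh (fst q) * cos (angular_dist (snd p) (snd q))"
    using assms by (intro mult_left_mono) auto
  then have "hyp_cosh p q \<le> cosh (fst p + fst q)"
    by (simp add: hyp_cosh_def cosh_add)
  also have "\<dots> < cosh R" using assms by (subst cosh_real_nonneg_less_iff) auto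
  finally show ?thesis .
qed

text \<open>The disk of radius \<open>R\<close> around \<open>p\<close> is convex, contains the origin and is symmetric about the
  ray through \<open>p\<close>, so moving \<open>q\<close> towards the origin or towards that ray keeps it adjacent.\<close>
lemma hyp_cosh_adjacent_mono:
  assumes "hyp_cosh p q < cosh R" "0 \<le> fst x" "fst x \<le> fst q" "0 \<le> fst p" "fst p < R"
    and "angular_dist (snd p) (snd x) \<le> angular_dist (snd p) (snd q)"
    and "snd p \<in> circle_angles" "snd q \<in> circle_angles" "snd x \<in> circle_angles"
  shows "hyp_cosh p x < cosh R"
proof -
  define c where "c = cos (angular_dist (snd p) (snd q))"
  \<comment> \<open>On the ray through q, the cosh of the distance from p is A * exp r + B * exp (-
    r) with nonnegative A and B. It is therefore convex, and it is below cosh R both at the origin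
    and at q.\<close>
  define A where "A = (cosh (fst p) - sinh (fst p) * c) / 2"
  define B where "B = (cosh (fst p) + sinh (fst p) * c) / 2"
  define f where "f = (\<lambda>r. A * exp r + B * exp (- r))"
  have "\<bar>sinh (fst p) * c\<bar> \<le> cosh (fst p)"
  proof -
    have "\<bar>sinh (fst p)\<bar> * \<bar>c\<bar> \<le> \<bar>sinh (fst p)\<bar> * 1"
      unfolding c_def by (intro mult_left_mono) auto
    then show ?thesis
      using assms sinh_le_cosh_real[of "fst p"] by (simp add: abs_mult)
  qed
  then have AB: "0 \<le> A" "0 \<le> B" by (auto simp: A_def B_def abs_le_iff)
  have f_eq: "f r = cosh (fst p) * cosh r - sinh (fst p) * sinh r * c" for r
    by (simp add: f_def A_def B_def cosh_field_def[of r] sinh_field_def[of r] field_simps)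
  have "f 0 < cosh R" using assms by (simp add: f_eq cosh_real_nonneg_less_iff)
  moreover have "f (fst q) < cosh R" using assms(1) by (simp add: f_eq hyp_cosh_def c_def)
  moreover have "f (fst x) \<le> max (f 0) (f (fst q))"
  proof -
    have "convex_on {0..fst q} f"
    proof -
      have "((\<lambda>r. A * exp r - B * exp (- r)) has_real_derivative A * exp r + B * exp (- r)) (at r)" for r
        by (auto intro!: derivative_eq_intros)
      moreover have "(f has_real_derivative A * exp r - B * exp (- r)) (at r)" for r
        unfolding f_def by (auto intro!: derivative_eq_intros)
      ultimately show ?thesis
        using AB by (intro f''_ge0_imp_convex[where f' = "\<lambda>r. A * exp r - B * exp (- r)"
            and f'' = "\<lambda>r. A * exp r + B * exp (- r)"]) auto
    qed
    then show ?thesis by (rule convex_on_le_max) (use assms in auto)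
  qed
  ultimately have "f (fst x) < cosh R" by (simp add: max_def split: if_splits)
  moreover have "hyp_cosh p x \<le> f (fst x)"
  proof -
    have "c \<le> cos (angular_dist (snd p) (snd x))"
      unfolding c_def using assms angular_dist_bounds by (intro cos_monotone_0_pi_le) auto
    then have "sinh (fst p) * sinh (fst x) * c \<le> sinh (fst p) * sinh (fst x) * cos (angular_dist (snd p) (snd x))"
      using assms by (intro mult_left_mono) auto
    then show ?thesis by (simp add: f_eq hyp_cosh_def)
  qed
  ultimately show ?thesis by simp
qed

text \<open>A partial converse of \<open>angular_dist_adjacent\<close> when r is within one of the
  radius of p. Only the point of radius exactly r at the angle of x is estimated; smaller radii
  follow from \<open>hyp_cosh_adjacent_mono\<close>.\<close>

lemma hyp_cosh_adjacent_near:
  assumes "0 \<le> r" "r \<le> fst p + 1" "fst p \<le> r + 1" "2 \<le> R" "fst p < R" "0 \<le> fst p"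
    and "0 \<le> fst x" "fst x \<le> r" "snd p \<in> circle_angles" "snd x \<in> circle_angles"
    and "angular_dist (snd p) (snd x) \<le> exp ((R - fst p - r) / 2)"
  shows "hyp_cosh p x < cosh R"
proof (rule hyp_cosh_adjacent_mono[where q = "(r, snd x)"])
  let ?t = "angular_dist (snd p) (snd x)"
  have t: "0 \<le> ?t" "?t \<le> pi" using angular_dist_bounds assms by auto
  have sinh_le: "sinh y \<le> exp y / 2" for y :: real by (simp add: sinh_field_def)
  have "sinh (fst p) * sinh r * (1 - cos ?t) \<le> exp (fst p) / 2 * (exp r / 2) * (?t\<^sup>2 / 2)"
    using assms one_minus_cos_bounds(2)[OF t] sinh_le by (intro mult_mono) auto
  also have "\<dots> \<le> exp (fst p) / 2 * (exp r / 2) * ((exp ((R - fst p - r) / 2))\<^sup>2 / 2)"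
    using assms t by (intro mult_left_mono divide_right_mono power_mono) auto
  also have "\<dots> = exp (fst p + r + (R - fst p - r)) / 8"
    unfolding exp_add by (simp flip: exp_double)
  also have "\<dots> = exp R / 8" by simp
  finally have 1: "sinh (fst p) * sinh r * (1 - cos ?t) \<le> exp R / 8" .
  have "cosh (fst p - r) = cosh \<bar>fst p - r\<bar>" by simp
  also have "\<dots> \<le> cosh 1" using assms by (subst cosh_real_nonneg_le_iff) auto
  also have "cosh (1::real) \<le> (e + 1) / 2" if "e = exp (1::real)" for e
    using that by (simp add: cosh_field_def)
  finally have 2: "cosh (fst p - r) \<le> (exp 1 + 1) / 2" by simp
  have e1: "exp (1::real) \<le> 3" using exp_le by simp
  \<comment> \<open>The two parts are at most exp R / 8 and 2; their sum is below exp R / 2 once exp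
    R > 16 / 3.\<close>
  have "exp (2::real) = exp 1 * exp 1" by (simp flip: exp_add)
  moreover have "5/2 \<le> exp (1::real)" using exp_lower_Taylor_quadratic[of 1] by simp
  then have "5/2 * (5/2) \<le> exp (1::real) * exp 1" by (intro mult_mono) auto
  ultimately have "6 \<le> exp (2::real)" by linarith
  then have "6 \<le> exp R" using assms exp_le_cancel_iff[of 2 R] by linarith
  with 1 2 e1 have "hyp_cosh p (r, snd x) < exp R / 2"
    unfolding hyp_cosh_alt by auto
  moreover have "exp R / 2 < cosh R" by (simp add: cosh_field_def)
  ultimately show "hyp_cosh p (r, snd x) < cosh R" by linarith
qed (use assms in auto)

section \<open>Outcomes with regular vertex counts\<close>

text \<open>A cell of full radius has expected population one, so b - a cells up to radius l expect,
  up to constants, (b - a) * exp (- \<alpha> * (R - l)) vertices. Discrete radii and angles keep the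
  number of boxes polynomial.\<close>

definition cell_box :: "nat \<Rightarrow> nat \<Rightarrow> nat \<Rightarrow> nat \<Rightarrow> (real \<times> real) set" where
  "cell_box n l a b = {..real l} \<times> {2 * pi * real a / real n..<2 * pi * real b / real n}"

text \<open>
  \<open>L\<close> is \<open>ln n\<close>; \<open>l0\<close> is the radius of the central disk; up to radius \<open>l1\<close> every vertex outside
  of the inner disk has a neighbor one level closer to the origin, and \<open>\<Gamma>\<close> is a polylogarithmic
  bound on the number of cells within which such a vertex is guaranteed, up to a factor \<open>8 * L\<close>.
\<close>
locale good_outcome =
  fixes \<alpha> C L \<Gamma> :: real and n l0 l1 :: nat and \<omega> :: "nat \<Rightarrow> real \<times> real"
  assumes alpha: "1 / 2 < \<alpha>" "\<alpha> < 1"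
    and radius: "v < n \<Longrightarrow> fst (\<omega> v) \<in> {0..<disk_radius C n}"
    and angle: "v < n \<Longrightarrow> snd (\<omega> v) \<in> circle_angles"
    and cell_upper: "l \<le> nat \<lceil>disk_radius C n\<rceil> \<Longrightarrow> a \<le> b \<Longrightarrow> b \<le> n \<Longrightarrow>
      real (card {v \<in> {..<n}. \<omega> v \<in> cell_box n l a b})
        \<le> 4 * (real (b - a) * exp (- \<alpha> * (disk_radius C n - real l)) + L)"
    and cell_lower: "4 \<le> l \<Longrightarrow> real l \<le> disk_radius C n \<Longrightarrow> a \<le> b \<Longrightarrow> b \<le> n \<Longrightarrow>
      8 * L \<le> real (b - a) * exp (- \<alpha> * (disk_radius C n - real l)) \<Longrightarrow>
      \<exists>v<n. \<omega> v \<in> cell_box n l a b"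
    and n_pos: "0 < n"
    and L_ge: "3 \<le> L" and R_ge: "2 \<le> disk_radius C n" and R_le: "disk_radius C n + 2 \<le> 3 * L"
    and l0: "4 \<le> l0" "real l0 \<le> disk_radius C n" "5 \<le> disk_radius C n - real l0"
      "disk_radius C n + 1 \<le> 2 * (disk_radius C n - real l0)"
      "8 * L \<le> real n * exp (- \<alpha> * (disk_radius C n - real l0))"
      "real n * exp (- \<alpha> * (disk_radius C n - real l0)) \<le> 24 * L"
    and l1: "4 \<le> l1" "real l1 \<le> disk_radius C n"
      "400 * L \<le> exp (- C / 2) * exp ((1 - \<alpha>) * (disk_radius C n - real l1))"
      "exp (disk_radius C n - real l1) \<le> \<Gamma>"
    and wide: "4 * (8 * L * \<Gamma> + 2) < real n"
begin

abbreviation "R \<equiv> disk_radius C n"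
abbreviation "rad v \<equiv> fst (\<omega> v)"
abbreviation "ang v \<equiv> snd (\<omega> v)"
abbreviation "E \<equiv> hrg_edges C n \<omega>"
abbreviation "c0 \<equiv> exp (- C / 2)"
abbreviation "\<rho> \<equiv> R - real l0"

lemma n_eq: "real n = c0 * exp (R / 2)"
  using n_pos by (simp add: disk_radius_def add_divide_distrib flip: exp_add)

lemma Gamma_ge: "1 \<le> \<Gamma>"
  using l1 one_le_exp_iff[of "R - real l1"] by linarith

lemma edge_iff: "(u, v) \<in> E \<longleftrightarrow> u < n \<and> v < n \<and> u \<noteq> v \<and> hyp_cosh (\<omega> u) (\<omega> v) < cosh R"
proof -
  have "u < n \<Longrightarrow> v < n \<Longrightarrow> hyp_dist (\<omega> u) (\<omega> v) < R \<longleftrightarrow> hyp_cosh (\<omega> u) (\<omega> v) < cosh R"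
    using radius[of u] radius[of v] R_ge by (intro hyp_dist_less_iff) auto
  then show ?thesis by (auto simp: hrg_edges_def)
qed

lemma sym_E: "sym E"
  by (auto simp: sym_def hrg_edges_def hyp_dist_commute)

lemma edge_less: "(u, v) \<in> E \<Longrightarrow> u < n \<and> v < n"
  by (simp add: hrg_edges_def)

lemma edge_angle: "(u, v) \<in> E \<Longrightarrow> angular_dist (ang u) (ang v) \<le> 17 * exp ((R - rad u - rad v) / 2)"
  using radius[of u] radius[of v] angle[of u] angle[of v] R_ge
  by (intro angular_dist_adjacent) (auto simp: edge_iff)

lemma layer_less: "s < n \<Longrightarrow> layer E s i \<subseteq> {..<n}"
  by (cases i) (auto dest: edge_less)

section \<open>Vertex counts in intervals and arcs of angles\<close>

text \<open>Rounding outward to cells costs two extra cells. The interval may leave the range of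
  angles and is clipped to it; a nonempty set ensures that the clipped cell range is not
  reversed.\<close>

lemma interval_upper:
  assumes "l \<le> nat \<lceil>R\<rceil>" "lo \<le> hi"
  shows "real (card {v \<in> {..<n}. rad v \<le> real l \<and> lo \<le> ang v \<and> ang v \<le> hi})
    \<le> 4 * ((real n * (hi - lo) / (2 * pi) + 2) * exp (- \<alpha> * (R - real l)) + L)"
    (is "real (card ?S) \<le> 4 * (?w * ?e + L)")
proof (cases "?S = {}")
  case True
  have "0 \<le> real n * (hi - lo) / (2 * pi)" using assms by (intro divide_nonneg_nonneg mult_nonneg_nonneg) auto
  then have "0 \<le> ?w" by linarith
  then have "0 \<le> ?w * ?e" by (intro mult_nonneg_nonneg) auto
  from add_nonneg_nonneg[OF this, of L] have "0 \<le> 4 * (?w * ?e + L)" using L_ge by simp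
  then show ?thesis unfolding True by simp
next
  case False
  then obtain v where v: "v < n" "lo \<le> ang v" "ang v \<le> hi" by auto
  define g where "g x = real n * x / (2 * pi)" for x
  have g: "x \<le> y \<longleftrightarrow> g x \<le> g y" "x < y \<longleftrightarrow> g x < g y" for x y
    using n_pos by (auto simp: g_def divide_le_cancel divide_less_cancel)
  have g_cell: "g (2 * pi * real a / real n) = real a" for a
    using n_pos by (simp add: g_def)
  have g2pi: "g (2 * pi) = real n" and g0: "g 0 = 0" by (simp_all add: g_def)
  define a where "a = nat \<lfloor>g (max 0 lo)\<rfloor>"
  define b where "b = min n (nat \<lfloor>g hi\<rfloor> + 1)"
  have gpos: "0 \<le> g (max 0 lo)" using g(1)[of 0 "max 0 lo"] by (simp add: g0)
  have a: "real a \<le> g (max 0 lo)" "g (max 0 lo) < real a + 1"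
    using gpos unfolding a_def by linarith+
  have hi0: "0 \<le> hi" using v angle[OF v(1)] by auto
  have ghi: "0 \<le> g hi" using g(1)[of 0 hi] hi0 by (simp add: g0)
  have maxlo: "max 0 lo \<le> ang v" using v angle[OF v(1)] by auto
  have "g (ang v) < real n" using g(2)[of "ang v" "2 * pi"] angle[OF v(1)] by (simp add: g2pi)
  moreover have "g (max 0 lo) \<le> g (ang v)" "g (ang v) \<le> g hi" using maxlo v g(1) by auto
  ultimately have ab: "a \<le> b" "b \<le> n"
    using a ghi unfolding b_def a_def by (auto simp: min_def) linarith+
  have "?S \<subseteq> {v \<in> {..<n}. \<omega> v \<in> cell_box n l a b}"
  proof safe
    fix u assume u: "u < n" "rad u \<le> real l" "lo \<le> ang u" "ang u \<le> hi"
    have "max 0 lo \<le> ang u" using u angle[OF u(1)] by auto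
    then have "real a \<le> g (ang u)" using a g(1)[of "max 0 lo" "ang u"] by simp
    moreover have "g (ang u) < real b"
    proof -
      have "g (ang u) < real n" using g(2)[of "ang u" "2 * pi"] angle[OF u(1)] by (simp add: g2pi)
      moreover have "g (ang u) \<le> g hi" using u g(1) by simp
      then have "g (ang u) < real (nat \<lfloor>g hi\<rfloor> + 1)" using ghi by linarith
      ultimately show ?thesis unfolding b_def by (simp add: min_def)
    qed
    ultimately have "2 * pi * real a / real n \<le> ang u" "ang u < 2 * pi * real b / real n"
      using g(1)[of "2 * pi * real a / real n" "ang u"] g(2)[of "ang u" "2 * pi * real b / real n"]
      unfolding g_cell by auto
    with u show "\<omega> u \<in> cell_box n l a b" by (cases "\<omega> u") (auto simp: cell_box_def)
  qed
  then have "real (card ?S) \<le> real (card {v \<in> {..<n}. \<omega> v \<in> cell_box n l a b})"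
    by (intro of_nat_mono card_mono) auto
  also have "\<dots> \<le> 4 * (real (b - a) * ?e + L)"
    by (rule cell_upper[OF assms(1) ab])
  also have "real (b - a) \<le> ?w"
  proof -
    have "real b \<le> g hi + 1" using ghi unfolding b_def by linarith
    moreover have "g lo \<le> g (max 0 lo)" using g(1)[of lo "max 0 lo"] by simp
    ultimately have "real b - real a \<le> g hi - g lo + 2" using a by linarith
    also have "\<dots> = ?w" by (simp add: g_def algebra_simps diff_divide_distrib)
    finally show ?thesis using ab by simp
  qed
  finally show ?thesis by simp
qed

text \<open>Rounding inward loses at most two cells, hence the \<open>- 2\<close>.\<close>

lemma interval_lower:
  assumes "4 \<le> l" "real l \<le> R" "0 \<le> lo" "hi \<le> 2 * pi"
    and "8 * L * exp (\<alpha> * (R - real l)) \<le> real n * (hi - lo) / (2 * pi) - 2"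
  shows "\<exists>v<n. rad v \<le> real l \<and> lo \<le> ang v \<and> ang v \<le> hi"
proof -
  define g where "g x = real n * x / (2 * pi)" for x
  have g: "x \<le> y \<longleftrightarrow> g x \<le> g y" for x y
    using n_pos by (auto simp: g_def divide_le_cancel)
  have g_cell: "g (2 * pi * real a / real n) = real a" for a
    using n_pos by (simp add: g_def)
  have g2pi: "g (2 * pi) = real n" and g0: "g 0 = 0" by (simp_all add: g_def)
  define a where "a = nat \<lceil>g lo\<rceil>"
  define b where "b = nat \<lfloor>g hi\<rfloor>"
  have w: "8 * L * exp (\<alpha> * (R - real l)) \<le> g hi - g lo - 2"
    using assms(5) by (simp add: g_def algebra_simps diff_divide_distrib)
  have "0 \<le> 8 * L * exp (\<alpha> * (R - real l))" using L_ge by simp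
  with w have w': "g lo + 2 \<le> g hi" by linarith
  have glo: "0 \<le> g lo" using g[of 0 lo] assms by (simp add: g0)
  have a: "g lo \<le> real a" "real a < g lo + 1" using glo unfolding a_def by linarith+
  have b: "real b \<le> g hi" "g hi < real b + 1" using glo w' unfolding b_def by linarith+
  have ab: "a \<le> b" using a b w' by linarith
  have bn: "b \<le> n" using b g[of hi "2 * pi"] assms by (simp add: g2pi)
  have "8 * L * exp (\<alpha> * (R - real l)) \<le> real (b - a)" using a b w ab by simp
  then have "8 * L * exp (\<alpha> * (R - real l)) * exp (- \<alpha> * (R - real l))
      \<le> real (b - a) * exp (- \<alpha> * (R - real l))"
    by (intro mult_right_mono) auto
  then have "8 * L \<le> real (b - a) * exp (- \<alpha> * (R - real l))"
    by (simp add: mult.assoc flip: exp_add)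
  from cell_lower[OF assms(1,2) ab bn this] obtain v where v: "v < n" "\<omega> v \<in> cell_box n l a b"
    by auto
  then have v': "rad v \<le> real l" "2 * pi * real a / real n \<le> ang v" "ang v < 2 * pi * real b / real n"
    by (cases "\<omega> v"; auto simp: cell_box_def)+
  have "lo \<le> 2 * pi * real a / real n" "2 * pi * real b / real n \<le> hi"
    using g[of lo "2 * pi * real a / real n"] g[of "2 * pi * real b / real n" hi] a b
    unfolding g_cell by auto
  with v v' show ?thesis by (intro exI[of _ v]) auto
qed

text \<open>The arc around \<psi> may wrap past the angle 0. The middle interval and the two end
  intervals of length x cover it in every case, which triples the constant 4.\<close>

lemma near_upper:
  assumes "l \<le> nat \<lceil>R\<rceil>" "0 \<le> x" "\<psi> \<in> circle_angles"
  shows "real (card {v \<in> {..<n}. rad v \<le> real l \<and> angular_dist (ang v) \<psi> \<le> x})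
    \<le> 12 * ((real n * x + 2) * exp (- \<alpha> * (R - real l)) + L)"
proof -
  define S where "S lo hi = {v \<in> {..<n}. rad v \<le> real l \<and> lo \<le> ang v \<and> ang v \<le> hi}" for lo hi
  have S: "real (card (S lo hi)) \<le> 4 * ((real n * x + 2) * exp (- \<alpha> * (R - real l)) + L)"
    if "lo \<le> hi" "hi - lo \<le> 2 * x" for lo hi
  proof -
    have "real n * (hi - lo) / (2 * pi) \<le> real n * (2 * x) / 2"
    proof (rule frac_le)
      show "real n * (hi - lo) \<le> real n * (2 * x)"
        by (rule mult_left_mono) (use that in auto)
    qed (use assms pi_ge_two in auto)
    then have "real n * (hi - lo) / (2 * pi) + 2 \<le> real n * x + 2" by simp
    then have "4 * ((real n * (hi - lo) / (2 * pi) + 2) * exp (- \<alpha> * (R - real l)) + L)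
        \<le> 4 * ((real n * x + 2) * exp (- \<alpha> * (R - real l)) + L)"
      by (intro mult_left_mono add_right_mono mult_right_mono) auto
    with interval_upper[OF assms(1) that(1)] show ?thesis unfolding S_def by linarith
  qed
  have "{v \<in> {..<n}. rad v \<le> real l \<and> angular_dist (ang v) \<psi> \<le> x}
      \<subseteq> S (\<psi> - x) (\<psi> + x) \<union> (S 0 x \<union> S (2 * pi - x) (2 * pi))"
  proof
    fix v assume "v \<in> {v \<in> {..<n}. rad v \<le> real l \<and> angular_dist (ang v) \<psi> \<le> x}"
    then have v: "v < n" "rad v \<le> real l" "angular_dist (ang v) \<psi> \<le> x" by auto
    then show "v \<in> S (\<psi> - x) (\<psi> + x) \<union> (S 0 x \<union> S (2 * pi - x) (2 * pi))"
      using angle[OF v(1)] assms(3) unfolding S_def angular_dist_def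
      by (auto simp: abs_if split: if_splits)
  qed
  then have "card {v \<in> {..<n}. rad v \<le> real l \<and> angular_dist (ang v) \<psi> \<le> x}
      \<le> card (S (\<psi> - x) (\<psi> + x) \<union> (S 0 x \<union> S (2 * pi - x) (2 * pi)))"
    by (intro card_mono) (auto simp: S_def)
  also have "\<dots> \<le> card (S (\<psi> - x) (\<psi> + x)) + (card (S 0 x) + card (S (2 * pi - x) (2 * pi)))"
    by (rule order_trans[OF card_Un_le add_left_mono[OF card_Un_le]])
  finally have "real (card {v \<in> {..<n}. rad v \<le> real l \<and> angular_dist (ang v) \<psi> \<le> x})
      \<le> real (card (S (\<psi> - x) (\<psi> + x))) + (real (card (S 0 x)) + real (card (S (2 * pi - x) (2 * pi))))"
    by linarith
  with S[of "\<psi> - x" "\<psi> + x"] S[of 0 x] S[of "2 * pi - x" "2 * pi"] assms(2) show ?thesis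
    by linarith
qed

text \<open>A level is a radius rounded up, so it may exceed R, but by at most one; both exponents
  are thus at most 1.\<close>

lemma level_exp: "l \<le> nat \<lceil>R\<rceil> \<Longrightarrow> exp (- \<alpha> * (R - real l)) \<le> 3"
  "l \<le> nat \<lceil>R\<rceil> \<Longrightarrow> exp ((1 / 2 - \<alpha>) * (R - real l)) \<le> 3"
proof -
  assume "l \<le> nat \<lceil>R\<rceil>"
  then have y: "real l - R \<le> 1" using R_ge by linarith
  have "\<alpha> * (real l - R) \<le> \<alpha> * 1" "(\<alpha> - 1 / 2) * (real l - R) \<le> (\<alpha> - 1 / 2) * 1"
    using y alpha by (intro mult_left_mono; simp)+
  then have "- \<alpha> * (R - real l) \<le> 1" "(1 / 2 - \<alpha>) * (R - real l) \<le> 1"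
    using alpha by (auto simp: algebra_simps)
  then have "exp (- \<alpha> * (R - real l)) \<le> exp 1" "exp ((1 / 2 - \<alpha>) * (R - real l)) \<le> exp 1"
    by auto
  then show "exp (- \<alpha> * (R - real l)) \<le> 3" "exp ((1 / 2 - \<alpha>) * (R - real l)) \<le> 3"
    using exp_le by linarith+
qed

lemma level_of:
  assumes "v < n"
  shows "nat \<lceil>rad v\<rceil> \<le> nat \<lceil>R\<rceil>" "rad v \<le> real (nat \<lceil>rad v\<rceil>)" "real (nat \<lceil>rad v\<rceil>) - 1 < rad v"
  using radius[OF assms] by (auto intro!: nat_mono ceiling_mono) linarith+

section \<open>Degrees\<close>

lemma exp_half_le: "exp (1 / 2 :: real) \<le> 2"
proof -
  have "exp (1::real) = (exp (1 / 2))\<^sup>2" by (simp flip: exp_double)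
  then have "(exp (1 / 2 :: real))\<^sup>2 \<le> 2\<^sup>2" using exp_le by simp
  then show ?thesis by (rule power2_le_imp_le) simp
qed

text \<open>Here 102 is 17 * 2 * 3, the angle bound times two rounding errors; 36 is the 12 of
  \<open>near_upper\<close> times the 3 from the at most 3 * L levels.\<close>

definition Kd :: real where "Kd = 36 * (102 * c0 + 3)"

lemma Kd_pos: "0 < Kd"
  by (simp add: Kd_def add_pos_pos)

text \<open>Neighbors are counted level by level. The admissible angle shrinks like exp (- l / 2)
  and the population grows like exp (\<alpha> * l); as \<alpha> > 1 / 2 the levels at the boundary
  dominate, and each level contributes at most order L * exp ((R - rad v) / 2). The second factor L
  is the number of levels.\<close>

lemma degree_le:
  assumes "v < n"
  shows "real (degree E v) \<le> Kd * L\<^sup>2 * exp ((R - rad v) / 2)"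
proof -
  define X where "X = exp ((R - rad v) / 2)"
  have X: "1 \<le> X" using radius[OF assms] by (simp add: X_def)
  \<comment> \<open>The \<open>+ 1\<close> pays for replacing the radius of a neighbor by its
    level.\<close>
  define x where "x l = 17 * exp ((R - rad v - real l + 1) / 2)" for l
  define S where "S l = {u \<in> {..<n}. rad u \<le> real l \<and> angular_dist (ang u) (ang v) \<le> x l}" for l :: nat
  have "E `` {v} \<subseteq> (\<Union>l\<le>nat \<lceil>R\<rceil>. S l)"
  proof
    fix u assume "u \<in> E `` {v}"
    then have e: "(u, v) \<in> E" using sym_E by (auto dest: symD)
    then have u: "u < n" using edge_less by auto
    have "angular_dist (ang u) (ang v) \<le> 17 * exp ((R - rad u - rad v) / 2)"
      by (rule edge_angle[OF e])
    also have "\<dots> \<le> x (nat \<lceil>rad u\<rceil>)" unfolding x_def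
      using level_of[OF u] by (intro mult_left_mono) auto
    finally have "u \<in> S (nat \<lceil>rad u\<rceil>)"
      using level_of[OF u] u by (simp add: S_def)
    then show "u \<in> (\<Union>l\<le>nat \<lceil>R\<rceil>. S l)"
      using level_of[OF u] by blast
  qed
  then have "degree E v \<le> card (\<Union>l\<le>nat \<lceil>R\<rceil>. S l)"
    unfolding degree_def by (intro card_mono) (auto simp: S_def)
  also have "\<dots> \<le> (\<Sum>l\<le>nat \<lceil>R\<rceil>. card (S l))" by (rule card_UN_le) simp
  finally have "real (degree E v) \<le> (\<Sum>l\<le>nat \<lceil>R\<rceil>. real (card (S l)))"
    unfolding of_nat_sum[symmetric] by (rule of_nat_mono)
  also have "\<dots> \<le> (\<Sum>l\<le>nat \<lceil>R\<rceil>. 12 * (102 * c0 + 3) * L * X)"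
  proof (rule sum_mono)
    fix l assume "l \<in> {..nat \<lceil>R\<rceil>}"
    then have l: "l \<le> nat \<lceil>R\<rceil>" by simp
    let ?e = "exp (- \<alpha> * (R - real l))"
    have "real (card (S l)) \<le> 12 * ((real n * x l + 2) * ?e + L)"
      unfolding S_def using angle[OF assms] by (intro near_upper[OF l]) (auto simp: x_def)
    also have "real n * x l * ?e = 17 * c0 * X * (exp (1 / 2) * exp ((1 / 2 - \<alpha>) * (R - real l)))"
    proof -
      have "R / 2 + (R - rad v - real l + 1) / 2 + - \<alpha> * (R - real l)
          = (R - rad v) / 2 + (1 / 2 + (1 / 2 - \<alpha>) * (R - real l))"
        by (simp add: field_simps)
      then have "exp (R / 2) * exp ((R - rad v - real l + 1) / 2) * ?e
          = X * (exp (1 / 2) * exp ((1 / 2 - \<alpha>) * (R - real l)))"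
        unfolding X_def exp_add[symmetric] by simp
      then show ?thesis unfolding x_def n_eq by simp
    qed
    then have "(real n * x l + 2) * ?e = 17 * c0 * X * (exp (1 / 2) * exp ((1 / 2 - \<alpha>) * (R - real l))) + 2 * ?e"
      by (simp add: algebra_simps)
    also have "\<dots> \<le> 17 * c0 * X * (2 * 3) + 2 * 3"
      using level_exp[OF l] exp_half_le X by (intro add_mono mult_left_mono mult_mono) auto
    finally have "real (card (S l)) \<le> 12 * (102 * c0 * X + 6 + L)" by (simp add: mult_ac)
    also have "\<dots> \<le> 12 * (102 * c0 * X * L + 3 * L * X)"
    proof -
      have 1: "102 * c0 * X * 1 \<le> 102 * c0 * X * L" using L_ge X by (intro mult_left_mono) auto
      have "3 * L * 1 \<le> 3 * L * X" using L_ge X by (intro mult_left_mono) auto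
      with L_ge have "6 + L \<le> 3 * L * X" by linarith
      with add_mono[OF 1 this] show ?thesis by (simp add: add.assoc)
    qed
    finally show "real (card (S l)) \<le> 12 * (102 * c0 + 3) * L * X"
      by (simp add: algebra_simps)
  qed
  also have "\<dots> = real (nat \<lceil>R\<rceil> + 1) * (12 * (102 * c0 + 3) * L * X)" by simp
  also have "\<dots> \<le> 3 * L * (12 * (102 * c0 + 3) * L * X)"
  proof (rule mult_right_mono)
    show "real (nat \<lceil>R\<rceil> + 1) \<le> 3 * L" using R_le R_ge by linarith
  qed (use L_ge X in \<open>auto intro!: mult_nonneg_nonneg add_nonneg_nonneg\<close>)
  also have "\<dots> = Kd * L\<^sup>2 * X" by (simp add: Kd_def power2_eq_square algebra_simps)
  finally show ?thesis by (simp add: X_def)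
qed

section \<open>Short paths to the central disk\<close>

lemma center:
  obtains z where "z < n" "rad z \<le> real l0"
proof -
  have "8 * L \<le> real (n - 0) * exp (- \<alpha> * (R - real l0))" using l0 by simp
  from cell_lower[OF l0(1,2) _ _ this] obtain v where "v < n" "\<omega> v \<in> cell_box n l0 0 n" by auto
  then show thesis by (intro that[of v]) (cases "\<omega> v"; auto simp: cell_box_def)+
qed

lemma center_adjacent:
  assumes "z < n" "rad z \<le> real l0" "v < n" "rad v < \<rho>" "v \<noteq> z"
  shows "(v, z) \<in> E"
  using assms radius[of v] radius[of z] hyp_cosh_adjacent_center[of "\<omega> v" "\<omega> z" R]
  by (auto simp: edge_iff)

text \<open>Vertices of radius at most l within angle x of v are adjacent to v. With y = R - l, a
  sector of that width expects order n * x * exp (- \<alpha> * y) of them, which is of order c0 *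
  exp ((1 - \<alpha>) * y) and, by the choice of l1, at least a large multiple of L.\<close>

lemma descend:
  assumes "v < n" "\<rho> \<le> rad v" "rad v \<le> real l1" "real l < rad v" "rad v \<le> real l + 1"
  shows "\<exists>b. (v, b) \<in> E \<and> rad b \<le> real l"
proof -
  define y where "y = R - real l"
  \<comment> \<open>The \<open>- 1\<close> accounts for a radius of v up to l + 1.\<close>
  define x where "x = exp ((R - 2 * real l - 1) / 2)"
  have x: "x \<le> 1" "0 < x" using assms l0 by (auto simp: x_def)
  have l: "4 \<le> l" "real l \<le> R" using assms l0 l1 by auto
  have y: "R - real l1 \<le> y" using assms by (simp add: y_def)
  have rv: "0 \<le> ang v" "ang v < 2 * pi" "rad v < R" "0 \<le> rad v"
    using angle[OF assms(1)] radius[OF assms(1)] by auto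
  have "400 * L * exp (\<alpha> * y) \<le> c0 * exp ((1 - \<alpha>) * y) * exp (\<alpha> * y)"
  proof (rule mult_right_mono)
    have "(1 - \<alpha>) * (R - real l1) \<le> (1 - \<alpha>) * y" using alpha y by (intro mult_left_mono) auto
    then have "c0 * exp ((1 - \<alpha>) * (R - real l1)) \<le> c0 * exp ((1 - \<alpha>) * y)" by simp
    then show "400 * L \<le> c0 * exp ((1 - \<alpha>) * y)" using l1 by linarith
  qed simp
  also have "\<dots> = c0 * exp y"
    by (simp add: mult.assoc left_diff_distrib flip: exp_add)
  finally have big: "400 * L * exp (\<alpha> * y) \<le> c0 * exp y" .
  have nx: "c0 * exp y \<le> 2 * (real n * x)"
  proof -
    have "exp (R / 2) * x = exp (y - 1 / 2)"
      unfolding x_def y_def exp_add[symmetric] by (simp add: field_simps)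
    then have "real n * x * exp (1 / 2) = c0 * (exp (y - 1 / 2) * exp (1 / 2))"
      by (simp add: n_eq mult.assoc)
    also have "exp (y - 1 / 2) * exp (1 / 2) = exp y" by (simp flip: exp_add)
    finally have "real n * x * exp (1 / 2) = c0 * exp y" .
    moreover have "real n * x * exp (1 / 2) \<le> real n * x * 2"
      using exp_half_le x by (intro mult_left_mono) auto
    ultimately show ?thesis by simp
  qed
  have "1 \<le> exp (\<alpha> * y)" using y alpha l1 by (simp add: y_def)
  then have "3 * 1 \<le> L * exp (\<alpha> * y)" using L_ge by (intro mult_mono) auto
  moreover have "400 * (L * exp (\<alpha> * y)) \<le> 2 * (real n * x)"
    using order_trans[OF big nx] unfolding mult.assoc .
  ultimately have "64 * (L * exp (\<alpha> * y)) + 16 \<le> real n * x" by linarith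
  then have "(8 * L * exp (\<alpha> * y) + 2) * 8 \<le> real n * x" by (simp add: algebra_simps)
  then have "(8 * L * exp (\<alpha> * y) + 2) * (2 * pi) \<le> real n * x"
    using pi_less_4 mult_left_mono[of "2 * pi" 8 "8 * L * exp (\<alpha> * y) + 2"] L_ge
    by (smt (verit) exp_gt_zero mult_nonneg_nonneg)
  then have cond: "8 * L * exp (\<alpha> * y) \<le> real n * x / (2 * pi) - 2"
    by (simp add: field_simps)
  have "\<exists>b<n. rad b \<le> real l \<and> \<bar>ang v - ang b\<bar> \<le> x"
  \<comment> \<open>As x is at most 1, the interval of length x on at least one side of v does not
    pass the angle 0.\<close>
  proof (cases "ang v + x \<le> 2 * pi")
    case True
    then show ?thesis
      using interval_lower[OF l, of "ang v" "ang v + x"] cond rv by (force simp: y_def)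
  next
    case False
    then have "0 \<le> ang v - x" using x pi_ge_two by linarith
    then show ?thesis
      using interval_lower[OF l, of "ang v - x" "ang v"] cond rv by (force simp: y_def)
  qed
  then obtain b where b: "b < n" "rad b \<le> real l" "\<bar>ang v - ang b\<bar> \<le> x" by auto
  have "hyp_cosh (\<omega> v) (\<omega> b) < cosh R"
  proof (rule hyp_cosh_adjacent_near[where r = "real l"])
    have "angular_dist (ang v) (ang b) \<le> x"
      using angular_dist_bounds(3)[OF angle[OF assms(1)] angle[OF b(1)]] b by simp
    also have "\<dots> \<le> exp ((R - rad v - real l) / 2)" using assms by (simp add: x_def)
    finally show "angular_dist (ang v) (ang b) \<le> exp ((R - rad v - real l) / 2)" .
  qed (use assms b rv angle radius[OF b(1)] R_ge in auto)
  then have "(v, b) \<in> E" using assms b by (auto simp: edge_iff)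
  with b show ?thesis by auto
qed

text \<open>Each descending edge lowers the rounded radius by at least one; below \<rho> at most one
  more edge leads to z.\<close>

lemma ring_to_center:
  assumes "z < n" "rad z \<le> real l0"
  shows "v < n \<Longrightarrow> rad v \<le> real l1 \<Longrightarrow> \<exists>k\<le>nat \<lceil>rad v\<rceil> + 1. (v, z) \<in> E ^^ k"
proof (induction "nat \<lceil>rad v\<rceil>" arbitrary: v rule: less_induct)
  case less
  show ?case
  proof (cases "rad v < \<rho>")
    case True
    show ?thesis
    proof (cases "v = z")
      case False
      then have "(v, z) \<in> E" using center_adjacent assms less True by auto
      then show ?thesis by (intro exI[of _ 1]) auto
    qed (auto intro!: exI[of _ 0])
  next
    case False
    define l where "l = nat \<lceil>rad v\<rceil> - 1"
    have "4 < rad v" using False l0 by auto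
    then have l: "real l < rad v" "rad v \<le> real l + 1" "nat \<lceil>rad v\<rceil> = l + 1"
      unfolding l_def by linarith+
    have "\<rho> \<le> rad v" using False by simp
    from descend[OF less.prems(1) this less.prems(2) l(1,2)] obtain b where
      b: "(v, b) \<in> E" "rad b \<le> real l" by auto
    have b': "b < n" using b edge_less by auto
    have bl: "nat \<lceil>rad b\<rceil> \<le> l" using b by (simp add: nat_le_iff ceiling_le_iff)
    have bl1: "rad b \<le> real l1" using b l less by linarith
    have "nat \<lceil>rad b\<rceil> < nat \<lceil>rad v\<rceil>" unfolding l(3) using bl by (rule le_imp_less_Suc[unfolded Suc_eq_plus1])
    from less.hyps[OF this b' bl1] obtain k where "k \<le> nat \<lceil>rad b\<rceil> + 1" and k2: "(b, z) \<in> E ^^ k"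
      by blast
    from order_trans[OF this(1) add_right_mono[OF bl]] k2
    have k: "k \<le> l + 1" "(b, z) \<in> E ^^ k" .
    then have "(v, z) \<in> E ^^ Suc k" using b by (meson relpow_Suc_I2)
    with k l(3) show ?thesis by (intro exI[of _ "Suc k"]) auto
  qed
qed

section \<open>Confinement of paths away from the ring, and the number of layers\<close>

text \<open>The ring stands for the vertices of radius at most \<open>l1\<close>. Neighbors count as
  near, so that a vertex that is not near has no edge into the ring; this is what blocks a path at
  the angle of a ring vertex.\<close>

definition near_ring :: "nat \<Rightarrow> bool" where
  "near_ring v \<longleftrightarrow> (\<exists>b<n. rad b \<le> real l1 \<and> (b = v \<or> (v, b) \<in> E))"

lemma near_ring_to_center:
  assumes "z < n" "rad z \<le> real l0" "near_ring v"
  shows "\<exists>k\<le>nat \<lceil>R\<rceil> + 2. (v, z) \<in> E ^^ k"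
proof -
  obtain b where b: "b < n" "rad b \<le> real l1" "b = v \<or> (v, b) \<in> E"
    using assms(3) by (auto simp: near_ring_def)
  from ring_to_center[OF assms(1,2) b(1,2)] obtain k where
    k: "k \<le> nat \<lceil>rad b\<rceil> + 1" "(b, z) \<in> E ^^ k" by auto
  have k': "k \<le> nat \<lceil>R\<rceil> + 1" using k level_of[OF b(1)] by linarith
  show ?thesis
  proof (cases "b = v")
    case True
    then show ?thesis using k k' by (intro exI[of _ k]) auto
  next
    case False
    then have "(v, z) \<in> E ^^ Suc k" using b k by (meson relpow_Suc_I2)
    then show ?thesis using k' by (intro exI[of _ "Suc k"]) auto
  qed
qed

lemma near_ring_connected:
  assumes "near_ring u" "near_ring v"
  shows "\<exists>k\<le>2 * (nat \<lceil>R\<rceil> + 2). (u, v) \<in> E ^^ k"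
proof -
  obtain z where z: "z < n" "rad z \<le> real l0" by (rule center)
  obtain k where k: "k \<le> nat \<lceil>R\<rceil> + 2" "(u, z) \<in> E ^^ k"
    using near_ring_to_center[OF z assms(1)] by auto
  obtain k' where k': "k' \<le> nat \<lceil>R\<rceil> + 2" "(v, z) \<in> E ^^ k'"
    using near_ring_to_center[OF z assms(2)] by auto
  have "(u, v) \<in> E ^^ (k + k')"
    unfolding relpow_add using k(2) relpow_sym[OF sym_E k'(2)] by auto
  with k(1) k'(1) show ?thesis by (intro exI[of _ "k + k'"]) auto
qed

text \<open>If w left the arc, then b or b' would be no farther from u in angle than w and of
  smaller radius, since w is outside the ring. \<open>hyp_cosh_adjacent_mono\<close> would make it a
  neighbor of u.\<close>

lemma blocked_edge:
  assumes "(u, w) \<in> E" "\<not> near_ring u" "\<not> near_ring w"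
    and b: "b < n" "rad b \<le> real l1" and b': "b' < n" "rad b' \<le> real l1"
    and u: "ang b \<le> ang u" "ang u \<le> ang b'"
  shows "ang b \<le> ang w \<and> ang w \<le> ang b'"
proof (rule ccontr)
  assume w: "\<not> (ang b \<le> ang w \<and> ang w \<le> ang b')"
  have uw: "u < n" "w < n" "hyp_cosh (\<omega> u) (\<omega> w) < cosh R" using assms(1) by (auto simp: edge_iff)
  have "\<not> rad w \<le> real l1" using assms(3) uw by (auto simp: near_ring_def)
  have blocker: False if c: "c < n" "rad c \<le> real l1"
    "angular_dist (ang u) (ang c) \<le> angular_dist (ang u) (ang w)" for c
  proof -
    have "hyp_cosh (\<omega> u) (\<omega> c) < cosh R"
      using c uw angle radius[of u] radius[of c] \<open>\<not> rad w \<le> real l1\<close>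
      by (intro hyp_cosh_adjacent_mono[OF uw(3)]) auto
    moreover have "u \<noteq> c" using assms(2) c by (auto simp: near_ring_def)
    ultimately have "(u, c) \<in> E" using uw c by (auto simp: edge_iff)
    with assms(2) c show False by (auto simp: near_ring_def)
  qed
  have "angular_dist (ang u) (ang b) \<le> angular_dist (ang u) (ang w) \<or>
      angular_dist (ang u) (ang b') \<le> angular_dist (ang u) (ang w)"
    using angular_dist_crossing[OF angle[OF uw(1)] angle[OF uw(2)] angle[OF b(1)] angle[OF b'(1)] u w] .
  then show False using blocker b b' by blast
qed

text \<open>Every interval of width W within the range of angles holds a ring vertex. By
  \<open>blocked_edge\<close> the path never enters or leaves the arc between two ring vertices, so
  it stays in at most two sectors of width 2 * W, with at most 220 * L * \<Gamma> vertices
  each.\<close>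

lemma far_path_confined:
  assumes path: "\<And>k. k < m \<Longrightarrow> (f k, f (Suc k)) \<in> E" "\<And>k. k \<le> m \<Longrightarrow> \<not> near_ring (f k)" "f 0 < n"
  shows "\<exists>Z\<subseteq>{..<n}. real (card Z) \<le> 440 * L * \<Gamma> \<and> (\<forall>k\<le>m. f k \<in> Z)"
proof -
  define W where "W = (8 * L * \<Gamma> + 2) * (2 * pi) / real n"
  have W: "real n * W / (2 * pi) = 8 * L * \<Gamma> + 2" using n_pos by (simp add: W_def)
  have LG: "L \<le> L * \<Gamma>" using L_ge Gamma_ge by simp
  have "0 < 8 * L * \<Gamma> + 2" using LG L_ge by linarith
  then have W0: "0 < W" using n_pos by (auto simp: W_def intro!: divide_pos_pos mult_pos_pos)
  have W4: "4 * W < 2 * pi"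
    using n_pos wide mult_strict_right_mono[OF wide, of "2 * pi"] by (simp add: W_def field_simps)
  have ring: "\<exists>b<n. rad b \<le> real l1 \<and> lo \<le> ang b \<and> ang b \<le> lo + W" if "0 \<le> lo" "lo + W \<le> 2 * pi" for lo
  proof (rule interval_lower[OF l1(1,2) that])
    have "\<alpha> * (R - real l1) \<le> 1 * (R - real l1)" using alpha l1 by (intro mult_right_mono) auto
    then have "exp (\<alpha> * (R - real l1)) \<le> exp (R - real l1)" by simp
    then have "exp (\<alpha> * (R - real l1)) \<le> \<Gamma>" using l1 by linarith
    then have "8 * L * exp (\<alpha> * (R - real l1)) \<le> 8 * L * \<Gamma>" using L_ge by (intro mult_left_mono) auto
    then show "8 * L * exp (\<alpha> * (R - real l1)) \<le> real n * (lo + W - lo) / (2 * pi) - 2"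
      using W by simp
  qed
  define S where "S lo = {v \<in> {..<n}. rad v \<le> real (nat \<lceil>R\<rceil>) \<and> lo \<le> ang v \<and> ang v \<le> lo + 2 * W}" for lo
  have in_S: "v \<in> S lo" if "v < n" "lo \<le> ang v" "ang v \<le> lo + 2 * W" for v lo
    using that level_of[OF that(1)] radius[OF that(1)] by (auto simp: S_def)
  have card_S: "real (card (S lo)) \<le> 220 * L * \<Gamma>" for lo
  proof -
    have "real (card (S lo)) \<le> 4 * ((real n * (lo + 2 * W - lo) / (2 * pi) + 2)
        * exp (- \<alpha> * (R - real (nat \<lceil>R\<rceil>))) + L)"
      unfolding S_def using W0 by (intro interval_upper) auto
    also have "real n * (lo + 2 * W - lo) / (2 * pi) + 2 = 2 * (8 * L * \<Gamma> + 2) + 2"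
      unfolding W[symmetric] by simp
    also have "4 * ((2 * (8 * L * \<Gamma> + 2) + 2) * exp (- \<alpha> * (R - real (nat \<lceil>R\<rceil>))) + L)
        \<le> 4 * ((2 * (8 * L * \<Gamma> + 2) + 2) * 3 + L)"
      using level_exp(1)[OF order_refl] LG L_ge
      by (intro mult_left_mono add_right_mono) auto
    also have "\<dots> \<le> 220 * L * \<Gamma>"
    proof -
      have "4 * ((2 * (8 * x + 2) + 2) * 3 + L) \<le> 220 * x" if "L \<le> x" for x
        using that L_ge by (simp add: algebra_simps)
      from this[OF LG] show ?thesis by (simp only: mult.assoc)
    qed
    finally show ?thesis .
  qed
  have fn: "f k < n" if "k \<le> m" for k
    using that path(1)[of "k - 1"] path(3) edge_less by (cases k) auto
  \<comment> \<open>An equivalence, because near the angle 0 it is the outside of an arc in which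
    the path is trapped.\<close>
  have inv: "(ang b \<le> ang (f k) \<and> ang (f k) \<le> ang b') = (ang b \<le> ang (f 0) \<and> ang (f 0) \<le> ang b')"
    if "k \<le> m" "b < n" "rad b \<le> real l1" "b' < n" "rad b' \<le> real l1" for k b b'
    using that(1)
  proof (induction k)
    case (Suc k)
    have e: "(f k, f (Suc k)) \<in> E" "(f (Suc k), f k) \<in> E"
      using path(1)[of k] Suc.prems sym_E by (auto dest: symD)
    have nr: "\<not> near_ring (f k)" "\<not> near_ring (f (Suc k))" using path(2) Suc.prems by auto
    show ?case
      using blocked_edge[OF e(1) nr that(2-)] blocked_edge[OF e(2) nr(2,1) that(2-)] Suc by auto
  qed simp
  have "\<exists>lo lo'. \<forall>k\<le>m. f k \<in> S lo \<union> S lo'"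
  proof (cases "W \<le> ang (f 0) \<and> ang (f 0) + W \<le> 2 * pi")
    case True
    obtain b where b: "b < n" "rad b \<le> real l1" "ang (f 0) - W \<le> ang b" "ang b \<le> ang (f 0)"
      using ring[of "ang (f 0) - W"] True angle[OF path(3)] by auto
    obtain b' where b': "b' < n" "rad b' \<le> real l1" "ang (f 0) \<le> ang b'" "ang b' \<le> ang (f 0) + W"
      using ring[of "ang (f 0)"] True angle[OF path(3)] by auto
    have "f k \<in> S (ang (f 0) - W)" if "k \<le> m" for k
      using inv[OF that b(1,2) b'(1,2)] b b' fn[OF that] by (intro in_S) auto
    then show ?thesis by blast
  next
    \<comment> \<open>The start is within W of the angle 0, where the linear order of angles breaks.
      Here b and b' bound the long arc that the path cannot enter, which leaves the two end
      sectors.\<close>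
    case False
    obtain b where b: "b < n" "rad b \<le> real l1" "W \<le> ang b" "ang b \<le> 2 * W"
      using ring[of W] W4 W0 by auto
    obtain b' where b': "b' < n" "rad b' \<le> real l1" "2 * pi - 2 * W \<le> ang b'" "ang b' \<le> 2 * pi - W"
      using ring[of "2 * pi - 2 * W"] W4 W0 by auto
    have "f k \<in> S 0 \<union> S (2 * pi - 2 * W)" if "k \<le> m" for k
    proof -
      have "\<not> (ang b \<le> ang (f k) \<and> ang (f k) \<le> ang b')"
        unfolding inv[OF that b(1,2) b'(1,2)] using False b b' by linarith
      then have "ang (f k) \<le> 2 * W \<or> 2 * pi - 2 * W \<le> ang (f k)" using b b' by linarith
      then show ?thesis
        using in_S[OF fn[OF that], of 0] in_S[OF fn[OF that], of "2 * pi - 2 * W"] angle[OF fn[OF that]] by auto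
    qed
    then show ?thesis by blast
  qed
  then obtain lo lo' where "\<forall>k\<le>m. f k \<in> S lo \<union> S lo'" by blast
  moreover have "real (card (S lo \<union> S lo')) \<le> 440 * L * \<Gamma>"
    using card_Un_le[of "S lo" "S lo'"] card_S[of lo] card_S[of lo'] by linarith
  moreover have "S lo \<union> S lo' \<subseteq> {..<n}" by (auto simp: S_def)
  ultimately show ?thesis by blast
qed

text \<open>Pigeonhole against the confining set.\<close>

lemma path_meets_near_ring:
  assumes path: "\<And>k. k < m \<Longrightarrow> (f k, f (Suc k)) \<in> E" and "inj_on f {..m}" "f 0 < n"
    and "440 * L * \<Gamma> < real m + 1"
  shows "\<exists>k\<le>m. near_ring (f k)"
proof (rule ccontr)
  assume "\<not> ?thesis"
  then obtain Z where Z: "Z \<subseteq> {..<n}" "real (card Z) \<le> 440 * L * \<Gamma>" "\<forall>k\<le>m. f k \<in> Z"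
    using far_path_confined[of m f] path assms(3) by blast
  have "card (f ` {..m}) \<le> card Z" using Z finite_subset[OF Z(1)] by (intro card_mono) auto
  then have "real (m + 1) \<le> real (card Z)" using card_image[OF assms(2)] by simp
  with Z(2) assms(4) show False by simp
qed

text \<open>Two end stretches of 440 * L * \<Gamma> each, with the remainder for a detour through
  the center of length of order R.\<close>

definition depth :: nat where "depth = nat \<lfloor>1000 * L * \<Gamma>\<rfloor>"

text \<open>Both the first M + 1 and the last M + 1 vertices of a BFS path to layer i include one
  near the ring. These two are joined by a walk of at most 2 * T edges, and layer indices are
  distances, so their positions differ by at most 2 * T.\<close>

lemma layer_depth:
  assumes "s < n" "layer E s i \<noteq> {}"
  shows "i \<le> depth"
proof -
  define M where "M = nat \<lfloor>440 * L * \<Gamma>\<rfloor>"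
  define T where "T = nat \<lceil>R\<rceil> + 2"
  have LG: "L \<le> L * \<Gamma>" using L_ge Gamma_ge by simp
  have M: "real M \<le> 440 * L * \<Gamma>" "440 * L * \<Gamma> < real M + 1"
    unfolding M_def using LG L_ge by linarith+
  have "i \<le> 2 * M + 2 * T"
  proof (rule ccontr)
    assume i: "\<not> ?thesis"
    obtain v where "v \<in> layer E s i" using assms by auto
    then obtain f where f: "f i = v" "\<forall>k\<le>i. f k \<in> layer E s k" "\<forall>k<i. (f k, f (Suc k)) \<in> E"
      using layer_path by metis
    have inj: "inj_on f {..i}"
    proof (rule inj_onI)
      fix x y assume "x \<in> {..i}" "y \<in> {..i}" "f x = f y"
      then show "x = y" using f(2) layer_unique[of "f x" E s x y] by fastforce
    qed
    have fn: "f k < n" if "k \<le> i" for k using f(2) layer_less[OF assms(1)] that by blast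
    have "\<exists>k\<le>M. near_ring (f k)"
      using f i fn by (intro path_meets_near_ring M(2) inj_on_subset[OF inj]) auto
    then obtain a where a: "a \<le> M" "near_ring (f a)" by auto
    have "\<exists>k\<le>M. near_ring (f (i - M + k))"
    proof (rule path_meets_near_ring[where f = "\<lambda>k. f (i - M + k)"])
      show "inj_on (\<lambda>k. f (i - M + k)) {..M}"
      proof (rule inj_onI)
        fix x y assume xy: "x \<in> {..M}" "y \<in> {..M}" "f (i - M + x) = f (i - M + y)"
        have "i - M + x = i - M + y" by (rule inj_onD[OF inj xy(3)]) (use xy i in auto)
        then show "x = y" by simp
      qed
      show "(f (i - M + k), f (i - M + Suc k)) \<in> E" if "k < M" for k
        using f(3) that i by auto
      show "f (i - M + 0) < n" using fn[of "i - M"] by simp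
    qed (rule M(2))
    then obtain c where c: "c \<le> M" "near_ring (f (i - M + c))" by auto
    from near_ring_connected[OF a(2) c(2)] obtain k where
      k: "k \<le> 2 * T" "(f a, f (i - M + c)) \<in> E ^^ k" by (auto simp: T_def)
    have "f a \<in> found E s a" using f(2) a i layer_subset_found by fastforce
    then have "f (i - M + c) \<in> found E s (a + k)" using k by (intro found_relpow)
    moreover have "f (i - M + c) \<in> layer E s (i - M + c)" using f(2) c i by auto
    ultimately have "i - M + c \<le> a + k" by (rule layer_found_le[rotated])
    with a k i show False by auto
  qed
  then have "real i \<le> real (2 * M + 2 * T)" by (rule of_nat_mono)
  also have "\<dots> \<le> 880 * L * \<Gamma> + 2 * (R + 3)" using M R_ge unfolding T_def by (simp add: of_nat_ceiling) linarith
  also have "\<dots> \<le> 1000 * L * \<Gamma>"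
  proof -
    have "880 * x + 2 * (R + 3) \<le> 1000 * x" if "L \<le> x" for x
      using that R_le L_ge by (simp add: algebra_simps)
    from this[OF LG] show ?thesis by (simp only: mult.assoc)
  qed
  finally show ?thesis by (simp add: depth_def le_nat_floor)
qed

section \<open>Cost of a layer that is preceded by outer vertices only\<close>

text \<open>The summands stem from the central disk, from the sector swept by outer edges, and from
  the widening by the last edge together with the additive counting error. The factor
  \<open>L ^ 3\<close> is the \<open>L\<^sup>2\<close> of \<open>degree_le\<close> times the number
  of levels.\<close>

definition cost_bound :: real where
  "cost_bound = 110 * L * real (max_degree {..<n} E)
     + 60000 * Kd * L ^ 3 * (real n * real depth * (17 * exp ((R - 2 * \<rho>) / 2)) + L * exp (\<rho> / 2))"

text \<open>Two outer vertices have R - rad u - rad p at most R - 2 * \<rho>, so every edge adds at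
  most the same angle.\<close>

lemma outer_layer_angle:
  assumes "s < n" "\<forall>k<i. \<forall>u\<in>layer E s k. \<rho> \<le> rad u"
  shows "k < i \<Longrightarrow> u \<in> layer E s k \<Longrightarrow>
    angular_dist (ang u) (ang s) \<le> real k * (17 * exp ((R - 2 * \<rho>) / 2))"
proof (induction k arbitrary: u)
  case 0
  then show ?case by (simp add: angular_dist_def)
next
  case (Suc k)
  from Suc.prems(2) obtain p where p: "p \<in> layer E s k" "(p, u) \<in> E" by (rule layer_Suc_pred)
  have e: "(u, p) \<in> E" using p sym_E by (auto dest: symD)
  have n: "u < n" "p < n" using e edge_less by auto
  have "\<rho> \<le> rad u" using assms(2) Suc.prems by blast
  moreover have "\<rho> \<le> rad p" using assms(2) Suc.prems(1) p Suc_lessD by blast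
  ultimately have "17 * exp ((R - rad u - rad p) / 2) \<le> 17 * exp ((R - 2 * \<rho>) / 2)" by simp
  then have "angular_dist (ang u) (ang p) \<le> 17 * exp ((R - 2 * \<rho>) / 2)"
    using edge_angle[OF e] by linarith
  moreover have "angular_dist (ang p) (ang s) \<le> real k * (17 * exp ((R - 2 * \<rho>) / 2))"
    using Suc.IH[OF _ p(1)] Suc.prems by simp
  ultimately show ?case
    using angular_dist_triangle[OF angle[OF n(1)] angle[OF n(2)] angle[OF assms(1)]]
    by (simp add: algebra_simps)
qed

lemma degree_le_max: "v < n \<Longrightarrow> degree E v \<le> max_degree {..<n} E"
  unfolding max_degree_def by (intro Max_ge) auto

text \<open>Layer i itself may reach inward. Its vertices of radius at most l0 number at most 103 *
  L and are charged the maximum degree; the others are counted level by level in a sector around s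
  and charged by \<open>degree_le\<close>.\<close>

lemma layer_cost_le:
  assumes "s < n" "\<forall>k<i. \<forall>u\<in>layer E s k. \<rho> \<le> rad u" "layer E s i \<noteq> {}"
  shows "real (layer_cost E s i) \<le> cost_bound"
proof -
  define h where "h = 17 * exp ((R - 2 * \<rho>) / 2)"
  \<comment> \<open>The turn accumulated by outer edges plus that of the last edge, whose first
    endpoint has radius at least \<rho> = R - l0; again \<open>+ 1\<close> pays for rounding to a
    level.\<close>
  define x where "x l = real depth * h + 17 * exp ((real l0 - real l + 1) / 2)" for l
  have h0: "0 \<le> real depth * h" by (simp add: h_def)
  have angle_le: "angular_dist (ang u) (ang s) \<le> real depth * h + 17 * exp ((real l0 - rad u) / 2)"
    if u: "u \<in> layer E s i" for u
  proof (cases i)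
    case 0
    then show ?thesis using u h0 by (simp add: angular_dist_def add_nonneg_nonneg)
  next
    case (Suc k)
    then obtain p where p: "p \<in> layer E s k" "(p, u) \<in> E" using u by (auto elim: layer_Suc_pred)
    have e: "(u, p) \<in> E" using p sym_E by (auto dest: symD)
    have n: "u < n" "p < n" using e edge_less by auto
    have "angular_dist (ang p) (ang s) \<le> real k * h"
      unfolding h_def using outer_layer_angle[OF assms(1,2) _ p(1)] Suc by simp
    also have "\<dots> \<le> real depth * h"
      using layer_depth[OF assms(1,3)] Suc by (intro mult_right_mono) (auto simp: h_def)
    finally have 1: "angular_dist (ang p) (ang s) \<le> real depth * h" .
    have "\<rho> \<le> rad p" using assms(2) p Suc by auto
    then have "17 * exp ((R - rad u - rad p) / 2) \<le> 17 * exp ((real l0 - rad u) / 2)" by simp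
    with edge_angle[OF e] have "angular_dist (ang u) (ang p) \<le> 17 * exp ((real l0 - rad u) / 2)"
      by linarith
    with 1 show ?thesis
      using angular_dist_triangle[OF angle[OF n(1)] angle[OF n(2)] angle[OF assms(1)]] by linarith
  qed
  have sub: "layer E s i \<subseteq> {..<n}" by (rule layer_less[OF assms(1)])
  then have fin: "finite (layer E s i)" by (rule finite_subset) simp
  define I where "I = {u \<in> layer E s i. rad u \<le> real l0}"
  define U where "U l = {u \<in> layer E s i. real l0 < rad u \<and> nat \<lceil>rad u\<rceil> = l}" for l
  define Q where "Q = real n * (real depth * h) + L * exp (\<rho> / 2)"
  have Q0: "0 \<le> Q" using h0 L_ge by (auto simp: Q_def intro!: add_nonneg_nonneg mult_nonneg_nonneg)
  have layer_split: "layer E s i \<subseteq> I \<union> (\<Union>l\<le>nat \<lceil>R\<rceil>. U l)"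
    using sub level_of by (auto simp: I_def U_def)
  have "real (layer_cost E s i) = (\<Sum>u\<in>layer E s i. real (degree E u))"
    by (simp add: layer_cost_def)
  also have "\<dots> \<le> (\<Sum>u\<in>I \<union> (\<Union>l\<le>nat \<lceil>R\<rceil>. U l). real (degree E u))"
    using layer_split fin by (intro sum_mono2) (auto simp: I_def U_def)
  also have "\<dots> = (\<Sum>u\<in>I. real (degree E u)) + (\<Sum>u\<in>(\<Union>l\<le>nat \<lceil>R\<rceil>. U l). real (degree E u))"
    using fin by (intro sum.union_disjoint) (auto simp: I_def U_def)
  also have "(\<Sum>u\<in>(\<Union>l\<le>nat \<lceil>R\<rceil>. U l). real (degree E u)) = (\<Sum>l\<le>nat \<lceil>R\<rceil>. \<Sum>u\<in>U l. real (degree E u))"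
    using fin by (intro sum.UNION_disjoint) (auto simp: U_def)
  also have "(\<Sum>u\<in>I. real (degree E u)) \<le> 110 * L * real (max_degree {..<n} E)"
  proof -
    have "l0 \<le> nat \<lceil>R\<rceil>" using l0 by linarith
    have "I \<subseteq> {v \<in> {..<n}. rad v \<le> real l0 \<and> 0 \<le> ang v \<and> ang v \<le> 2 * pi}"
      using sub angle by (force simp: I_def)
    then have "real (card I) \<le> real (card {v \<in> {..<n}. rad v \<le> real l0 \<and> 0 \<le> ang v \<and> ang v \<le> 2 * pi})"
      by (intro of_nat_mono card_mono) auto
    also have "\<dots> \<le> 4 * ((real n * (2 * pi - 0) / (2 * pi) + 2) * exp (- \<alpha> * \<rho>) + L)"
      by (rule interval_upper[OF \<open>l0 \<le> nat \<lceil>R\<rceil>\<close>]) simp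
    also have "\<dots> = 4 * (real n * exp (- \<alpha> * \<rho>) + 2 * exp (- \<alpha> * \<rho>) + L)"
      by (simp add: algebra_simps)
    also have "\<dots> \<le> 4 * (24 * L + 2 + L)"
      using alpha l0 by (intro mult_left_mono add_mono) auto
    also have "\<dots> \<le> 103 * L" using L_ge by simp
    finally have "real (card I) \<le> 103 * L" .
    then have "real (card I) * real (max_degree {..<n} E) \<le> 110 * L * real (max_degree {..<n} E)"
      using L_ge by (intro mult_right_mono) auto
    moreover have "(\<Sum>u\<in>I. real (degree E u)) \<le> real (card I) * real (max_degree {..<n} E)"
      using sub degree_le_max by (intro sum_bounded_above of_nat_mono) (auto simp: I_def)
    ultimately show ?thesis by linarith
  qed
  also have "(\<Sum>l\<le>nat \<lceil>R\<rceil>. \<Sum>u\<in>U l. real (degree E u)) \<le> (\<Sum>l\<le>nat \<lceil>R\<rceil>. 20000 * Kd * L\<^sup>2 * Q)"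
  proof (rule sum_mono)
    fix l assume "l \<in> {..nat \<lceil>R\<rceil>}"
    then have l: "l \<le> nat \<lceil>R\<rceil>" by simp
    show "(\<Sum>u\<in>U l. real (degree E u)) \<le> 20000 * Kd * L\<^sup>2 * Q"
    proof (cases "U l = {}")
      case True
      show ?thesis using Q0 Kd_pos unfolding True by simp
    next
      case False
      define y where "y = R - real l"
      define e where "e = exp (- \<alpha> * y)"
      define g where "g = exp (\<rho> / 2)"
      define q where "q = exp (1 / 2 :: real)"
      have q: "0 \<le> q" "q \<le> 2" using exp_half_le by (auto simp: q_def)
      obtain v where v: "v \<in> layer E s i" "real l0 < rad v" "nat \<lceil>rad v\<rceil> = l"
        using False by (auto simp: U_def)
      then have "rad v \<le> real l" using level_of(2)[of v] sub by auto
      with v have y: "y \<le> \<rho>" by (simp add: y_def)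
      have g: "1 \<le> g" using l0 by (simp add: g_def)
      have "exp ((1 / 2 - \<alpha>) * y) \<le> 3" using level_exp(2)[OF l] by (simp add: y_def)
      then have f: "exp (y / 2) * e \<le> 3" by (simp add: e_def algebra_simps flip: exp_add)
      have yq: "exp ((y + 1) / 2) = q * exp (y / 2)"
        by (simp add: q_def add_divide_distrib flip: exp_add)
      have xl: "x l = real depth * h + 17 * (exp ((y - \<rho>) / 2) * q)"
        by (simp add: x_def q_def y_def add_divide_distrib flip: exp_add)
      \<comment> \<open>The combined exponent is (1 - \<alpha>) * y - \<rho> / 2. It grows with y,
        so y = \<rho> is the worst case, where the choice of l0 applies.\<close>
      have "real n * (exp ((y - \<rho>) / 2) * e * exp (y / 2)) \<le> real n * (exp (- \<alpha> * \<rho>) * g)"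
      proof (rule mult_left_mono)
        have "(1 - \<alpha>) * y \<le> (1 - \<alpha>) * \<rho>" using alpha y by (intro mult_left_mono) auto
        then have "(y - \<rho>) / 2 + - \<alpha> * y + y / 2 \<le> - \<alpha> * \<rho> + \<rho> / 2" by (simp add: field_simps)
        then show "exp ((y - \<rho>) / 2) * e * exp (y / 2) \<le> exp (- \<alpha> * \<rho>) * g"
          unfolding e_def g_def exp_add[symmetric] by simp
      qed simp
      also have "\<dots> \<le> 24 * L * g"
        using l0(6) g mult_right_mono[OF l0(6), of g] by (simp add: mult.assoc)
      finally have far: "real n * (exp ((y - \<rho>) / 2) * e * exp (y / 2)) \<le> 24 * L * g" .
      have Lg: "3 \<le> L * g" using L_ge g mult_mono[of 3 L 1 g] by simp
      have "((real n * x l + 2) * e + L) * exp ((y + 1) / 2)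
          = q * ((real n * (real depth * h) + 2) * (exp (y / 2) * e)
            + 17 * q * (real n * (exp ((y - \<rho>) / 2) * e * exp (y / 2))) + L * exp (y / 2))"
        unfolding xl yq by (simp add: algebra_simps)
      also have "\<dots> \<le> 2 * ((real n * (real depth * h) + 2) * 3 + 17 * 2 * (24 * L * g) + L * g)"
      proof (rule mult_mono)
        have nh: "0 \<le> real n * (real depth * h) + 2" using h0 by (simp add: add_nonneg_nonneg)
        have "(real n * (real depth * h) + 2) * (exp (y / 2) * e) \<le> (real n * (real depth * h) + 2) * 3"
          by (rule mult_left_mono[OF f nh])
        moreover have "17 * q * (real n * (exp ((y - \<rho>) / 2) * e * exp (y / 2))) \<le> 17 * 2 * (24 * L * g)"
          by (rule mult_mono[OF _ far]) (use q in \<open>auto simp: e_def\<close>)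
        moreover have "L * exp (y / 2) \<le> L * g"
          using y L_ge by (intro mult_left_mono) (auto simp: g_def)
        ultimately show "(real n * (real depth * h) + 2) * (exp (y / 2) * e)
            + 17 * q * (real n * (exp ((y - \<rho>) / 2) * e * exp (y / 2))) + L * exp (y / 2)
            \<le> (real n * (real depth * h) + 2) * 3 + 17 * 2 * (24 * L * g) + L * g"
          by (rule add_mono[OF add_mono])
        have "0 \<le> (real n * (real depth * h) + 2) * (exp (y / 2) * e)"
          using nh by (intro mult_nonneg_nonneg) (auto simp: e_def)
        moreover have "0 \<le> 17 * q * (real n * (exp ((y - \<rho>) / 2) * e * exp (y / 2)))"
          using q by (intro mult_nonneg_nonneg) (auto simp: e_def)
        moreover have "0 \<le> L * exp (y / 2)" using L_ge by simp
        ultimately show "0 \<le> (real n * (real depth * h) + 2) * (exp (y / 2) * e)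
            + 17 * q * (real n * (exp ((y - \<rho>) / 2) * e * exp (y / 2))) + L * exp (y / 2)"
          by (intro add_nonneg_nonneg)
      qed (use q in auto)
      also have "\<dots> \<le> 1640 * Q"
      proof -
        have "2 * ((a + 2) * 3 + 17 * 2 * (24 * L * g) + L * g) \<le> 1640 * (a + L * g)" if "0 \<le> a" for a
          using that Lg by (simp add: algebra_simps)
        from this[of "real n * (real depth * h)"] show ?thesis
          unfolding Q_def g_def[symmetric] using h0 by (auto intro: mult_nonneg_nonneg)
      qed
      finally have fin_bound: "((real n * x l + 2) * e + L) * exp ((y + 1) / 2) \<le> 1640 * Q" .
      have "(\<Sum>u\<in>U l. real (degree E u)) \<le> real (card (U l)) * (Kd * L\<^sup>2 * exp ((y + 1) / 2))"
      proof (rule sum_bounded_above)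
        fix u assume u: "u \<in> U l"
        then have "u < n" using sub by (auto simp: U_def)
        then have "real l - 1 < rad u" using level_of(3)[of u] u by (auto simp: U_def)
        then have "exp ((R - rad u) / 2) \<le> exp ((y + 1) / 2)" by (simp add: y_def)
        then have "Kd * L\<^sup>2 * exp ((R - rad u) / 2) \<le> Kd * L\<^sup>2 * exp ((y + 1) / 2)"
          using Kd_pos by (intro mult_left_mono) auto
        with degree_le[OF \<open>u < n\<close>] show "real (degree E u) \<le> Kd * L\<^sup>2 * exp ((y + 1) / 2)"
          by linarith
      qed
      also have "\<dots> \<le> 12 * ((real n * x l + 2) * e + L) * (Kd * L\<^sup>2 * exp ((y + 1) / 2))"
      proof (rule mult_right_mono)
        have "U l \<subseteq> {v \<in> {..<n}. rad v \<le> real l \<and> angular_dist (ang v) (ang s) \<le> x l}"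
        proof
          fix u assume u: "u \<in> U l"
          then have "u < n" using sub by (auto simp: U_def)
          then have lu: "real l - 1 < rad u" "rad u \<le> real l"
            using level_of[of u] u by (auto simp: U_def)
          then have lx: "17 * exp ((real l0 - rad u) / 2) \<le> 17 * exp ((real l0 - real l + 1) / 2)"
            by simp
          have "u \<in> layer E s i" using u by (simp add: U_def)
          from order_trans[OF angle_le[OF this] add_left_mono[OF lx]]
          have "angular_dist (ang u) (ang s) \<le> x l" unfolding x_def .
          then show "u \<in> {v \<in> {..<n}. rad v \<le> real l \<and> angular_dist (ang v) (ang s) \<le> x l}"
            using \<open>u < n\<close> lu by simp
        qed
        then have "real (card (U l)) \<le> real (card {v \<in> {..<n}. rad v \<le> real l \<and> angular_dist (ang v) (ang s) \<le> x l})"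
          by (intro of_nat_mono card_mono) auto
        also have "\<dots> \<le> 12 * ((real n * x l + 2) * e + L)"
          unfolding e_def y_def using h0
          by (intro near_upper[OF l _ angle[OF assms(1)]]) (auto simp: x_def add_nonneg_nonneg)
        finally show "real (card (U l)) \<le> 12 * ((real n * x l + 2) * e + L)" .
      qed (use Kd_pos in simp)
      also have "\<dots> = 12 * Kd * L\<^sup>2 * (((real n * x l + 2) * e + L) * exp ((y + 1) / 2))"
        by (simp add: mult_ac)
      also have "\<dots> \<le> 12 * Kd * L\<^sup>2 * (1640 * Q)"
        using Kd_pos by (intro mult_left_mono fin_bound) auto
      also have "\<dots> \<le> 20000 * Kd * L\<^sup>2 * Q"
      proof -
        have "0 \<le> Kd * L\<^sup>2 * Q" using Kd_pos Q0 by simp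
        then show ?thesis by (simp add: mult_ac)
      qed
      finally show ?thesis .
    qed
  qed
  also have "\<dots> = real (nat \<lceil>R\<rceil> + 1) * (20000 * Kd * L\<^sup>2 * Q)" by simp
  also have "\<dots> \<le> 3 * L * (20000 * Kd * L\<^sup>2 * Q)"
  proof (rule mult_right_mono)
    show "real (nat \<lceil>R\<rceil> + 1) \<le> 3 * L" using R_le R_ge by linarith
  qed (use Q0 Kd_pos in simp)
  finally show ?thesis
    by (simp add: cost_bound_def Q_def h_def power2_eq_square power3_eq_cube algebra_simps)
qed

lemma cheap_search:
  assumes "s < n" "t < n" "real (2 * depth + 1) * cost_bound \<le> b"
  shows "computes_shortest_path_within (greedy E s t) E s t b"
proof (rule greedy_search_cost[OF sym_E layer_depth[OF assms(1)] layer_depth[OF assms(2)] _ _ assms(3)])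
  show "0 \<le> cost_bound"
    using L_ge Kd_pos unfolding cost_bound_def by (intro add_nonneg_nonneg mult_nonneg_nonneg) auto
  fix i j assume ij: "layer E s i \<noteq> {}" "layer E t j \<noteq> {}" and sep: "found E s i \<inter> found E t j = {}"
  obtain z where z: "z < n" "rad z \<le> real l0" by (rule center)
  \<comment> \<open>Strictness of \<open>k < i\<close> matters: layer k has been explored, so its
    neighbor z is found. An inner vertex in the current layer i has no such effect yet.\<close>
  have hit: "z \<in> found E v i" if "v < n" "k < i" "u \<in> layer E v k" "rad u < \<rho>" for v i k u
  proof -
    have u: "u \<in> found E v k" using subsetD[OF layer_subset_found that(3)] .
    have "u < n" using layer_less[OF that(1)] that(3) by auto
    then have "u = z \<or> (u, z) \<in> E" using center_adjacent[OF z] that by auto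
    then have "z \<in> found E v (Suc k)" using u found_step[OF u] found_mono[of k "Suc k" E v] by auto
    then show ?thesis using found_mono[of "Suc k" i E v] that by auto
  qed
  have "(\<forall>k<i. \<forall>u\<in>layer E s k. \<rho> \<le> rad u) \<or> (\<forall>k<j. \<forall>u\<in>layer E t k. \<rho> \<le> rad u)"
    using hit[OF assms(1)] hit[OF assms(2)] sep by (meson disjoint_iff linorder_not_less)
  then show "real (min (layer_cost E s i) (layer_cost E t j)) \<le> cost_bound"
    using layer_cost_le[OF assms(1) _ ij(1)] layer_cost_le[OF assms(2) _ ij(2)] by fastforce
qed

end

section \<open>Concentration of the vertex counts\<close>

context
  fixes M :: "'a measure" and I :: "'i set" and A :: "'a set"
  assumes M: "prob_space M" and I: "finite I" and A: "A \<in> sets M"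
begin

interpretation M: prob_space M by (rule M)
interpretation product_prob_space "\<lambda>_. M" I by standard

lemma measurable_hits:
  "Measurable.pred (Pi\<^sub>M I (\<lambda>_. M)) (\<lambda>\<omega>. Q (card {v \<in> I. \<omega> v \<in> A}))"
proof -
  note A [measurable]
  have "(\<lambda>\<omega>. \<Sum>v\<in>I. if \<omega> v \<in> A then 1 else 0 :: nat) \<in> measurable (Pi\<^sub>M I (\<lambda>_. M)) (count_space UNIV)"
    by measurable
  moreover have "(\<Sum>v\<in>I. if \<omega> v \<in> A then 1 else 0 :: nat) = card {v \<in> I. \<omega> v \<in> A}" for \<omega>
    using I by (simp add: sum.If_cases Int_def)
  ultimately have "(\<lambda>\<omega>. card {v \<in> I. \<omega> v \<in> A}) \<in> measurable (Pi\<^sub>M I (\<lambda>_. M)) (count_space UNIV)"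
    by simp
  then show ?thesis by (rule measurable_compose) simp
qed

text \<open>By independence the probability is (1 - p)^n, and 1 - p <= exp (- p).\<close>

lemma prob_no_hit:
  "measure (Pi\<^sub>M I (\<lambda>_. M)) {\<omega> \<in> space (Pi\<^sub>M I (\<lambda>_. M)). \<forall>v\<in>I. \<omega> v \<notin> A} \<le> exp (- (real (card I) * measure M A))"
proof -
  have "{\<omega> \<in> space (Pi\<^sub>M I (\<lambda>_. M)). \<forall>v\<in>I. \<omega> v \<notin> A} = Pi\<^sub>E I (\<lambda>_. space M - A)"
    by (auto simp: space_PiM PiE_iff extensional_def)
  moreover have "emeasure (Pi\<^sub>M I (\<lambda>_. M)) (Pi\<^sub>E I (\<lambda>_. space M - A)) = (\<Prod>i\<in>I. emeasure M (space M - A))"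
    using I A by (intro emeasure_PiM) auto
  ultimately have "measure (Pi\<^sub>M I (\<lambda>_. M)) {\<omega> \<in> space (Pi\<^sub>M I (\<lambda>_. M)). \<forall>v\<in>I. \<omega> v \<notin> A}
      = (1 - measure M A) ^ card I"
    using M.prob_compl[OF A] by (simp add: measure_def[of "Pi\<^sub>M I (\<lambda>_. M)"] M.emeasure_eq_measure ennreal_power)
  also have "\<dots> \<le> exp (- measure M A) ^ card I"
    using exp_ge_add_one_self[of "- measure M A"] by (intro power_mono) auto
  also have "\<dots> = exp (- (real (card I) * measure M A))"
    by (simp flip: exp_of_nat_mult)
  finally show ?thesis .
qed

text \<open>Chernoff with parameter 1: the moment exp of the count is at most exp (2 * n * p),
  because exp 1 - 1 <= 2, and Markov's inequality at exp (2 * n * p + x) finishes.\<close>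

lemma prob_many_hits:
  "measure (Pi\<^sub>M I (\<lambda>_. M)) {\<omega> \<in> space (Pi\<^sub>M I (\<lambda>_. M)).
      2 * (real (card I) * measure M A) + x \<le> real (card {v \<in> I. \<omega> v \<in> A})} \<le> exp (- x)"
proof -
  define m where "m = 2 * (real (card I) * measure M A)"
  define f where "f = (\<lambda>y. exp (indicator A y) :: real)"
  have f_eq: "f = (\<lambda>y. 1 + (exp 1 - 1) * indicator A y)"
    by (auto simp: f_def indicator_def)
  have f_int: "integrable M f"
  proof (rule M.integrable_const_bound[where B = "exp 1"])
    show "f \<in> borel_measurable M" unfolding f_eq using A by measurable
  qed (auto simp: f_def indicator_def)
  have "integral\<^sup>L M f = 1 + (exp 1 - 1) * measure M A"
    unfolding f_eq using A by (simp add: M.prob_space M.emeasure_eq_measure)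
  also have "\<dots> \<le> 1 + 2 * measure M A" using exp_le by (intro add_left_mono mult_right_mono) auto
  also have "\<dots> \<le> exp (2 * measure M A)" by (rule exp_ge_add_one_self)
  finally have f_le: "integral\<^sup>L M f \<le> exp (2 * measure M A)" .
  have prod_eq: "(\<Prod>v\<in>I. f (\<omega> v)) = exp (real (card {v \<in> I. \<omega> v \<in> A}))" for \<omega>
  proof -
    have "real (card {v \<in> I. \<omega> v \<in> A}) = (\<Sum>v\<in>I. indicator A (\<omega> v))"
      using I by (simp add: indicator_def sum.If_cases Int_def)
    then show ?thesis using I by (simp add: f_def exp_sum)
  qed
  have "integrable (Pi\<^sub>M I (\<lambda>_. M)) (\<lambda>\<omega>. \<Prod>v\<in>I. f (\<omega> v))"
    by (rule product_integrable_prod[OF I f_int])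
  then have "measure (Pi\<^sub>M I (\<lambda>_. M)) {\<omega> \<in> space (Pi\<^sub>M I (\<lambda>_. M)). exp (m + x) \<le> (\<Prod>v\<in>I. f (\<omega> v))}
      \<le> (\<integral>\<omega>. (\<Prod>v\<in>I. f (\<omega> v)) \<partial>Pi\<^sub>M I (\<lambda>_. M)) / exp (m + x)"
    by (rule integral_Markov_inequality_measure[OF _ sets.empty_sets])
      (auto simp: f_def intro!: AE_I2 prod_nonneg)
  also have "(\<integral>\<omega>. (\<Prod>v\<in>I. f (\<omega> v)) \<partial>Pi\<^sub>M I (\<lambda>_. M)) = integral\<^sup>L M f ^ card I"
    by (simp add: product_integral_prod[OF I f_int])
  also have "integral\<^sup>L M f ^ card I / exp (m + x) \<le> exp (2 * measure M A) ^ card I / exp (m + x)"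
  proof (intro divide_right_mono power_mono f_le)
    show "0 \<le> integral\<^sup>L M f" by (rule Bochner_Integration.integral_nonneg) (simp add: f_def)
  qed simp
  also have "exp (2 * measure M A) ^ card I = exp m" by (simp add: m_def flip: exp_of_nat_mult)
  also have "exp m / exp (m + x) = exp (- x)" by (simp flip: exp_diff)
  finally show ?thesis unfolding prod_eq m_def by simp
qed

end

section \<open>Distribution of the radius and the angle of one vertex\<close>

context
  fixes \<alpha> R :: real
  assumes pos: "0 < \<alpha>" "0 < R"
begin

lemma cosh_gt_1: "0 < cosh (\<alpha> * R) - 1"
  using cosh_real_strict_mono[of 0 "\<alpha> * R"] pos by simp

lemma borel_radius_density [measurable]:
  "(\<lambda>r. ennreal (\<alpha> * sinh (\<alpha> * r) / (cosh (\<alpha> * R) - 1)) * indicator {0..R} r) \<in> borel_measurable borel"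
proof -
  have [measurable]: "(\<lambda>r. \<alpha> * sinh (\<alpha> * r) / (cosh (\<alpha> * R) - 1)) \<in> borel_measurable borel"
    by (intro borel_measurable_continuous_onI continuous_intros) (use cosh_gt_1 in auto)
  show ?thesis by measurable
qed

lemma emeasure_radius_measure:
  assumes "0 \<le> x" "x \<le> R"
  shows "emeasure (radius_measure \<alpha> R) {..x} = ennreal ((cosh (\<alpha> * x) - 1) / (cosh (\<alpha> * R) - 1))"
proof -
  define c where "c = cosh (\<alpha> * R) - 1"
  have c: "0 < c" using cosh_gt_1 by (simp add: c_def)
  have "emeasure (radius_measure \<alpha> R) {..x}
      = (\<integral>\<^sup>+r. (ennreal (\<alpha> * sinh (\<alpha> * r) / c) * indicator {0..R} r) * indicator {..x} r \<partial>lborel)"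
    unfolding radius_measure_def c_def by (rule emeasure_density) auto
  also have "\<dots> = (\<integral>\<^sup>+r. ennreal (\<alpha> * sinh (\<alpha> * r) / c) * indicator {0..x} r \<partial>lborel)"
    using assms by (intro nn_integral_cong) (auto simp: indicator_def)
  also have "\<dots> = ennreal (cosh (\<alpha> * x) / c - cosh (\<alpha> * 0) / c)"
  proof (rule nn_integral_FTC_Icc[where F = "\<lambda>r. cosh (\<alpha> * r) / c"])
    show "(\<lambda>r. \<alpha> * sinh (\<alpha> * r) / c) \<in> borel_measurable borel"
      by (intro borel_measurable_continuous_onI continuous_intros) (use c in auto)
    show "((\<lambda>r. cosh (\<alpha> * r) / c) has_real_derivative \<alpha> * sinh (\<alpha> * r) / c) (at r)" for r
      using c by (auto intro!: derivative_eq_intros)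
    show "0 \<le> \<alpha> * sinh (\<alpha> * r) / c" if "r \<in> {0..x}" for r
      using that pos c by simp
  qed (use assms in auto)
  finally show ?thesis by (simp add: c_def diff_divide_distrib)
qed

text \<open>Dropping the null set of radius exactly R keeps the origin strictly closer than R to
  every vertex, which \<open>hyp_cosh_adjacent_mono\<close> uses.\<close>

lemma AE_radius_measure: "AE r in radius_measure \<alpha> R. r \<in> {0..<R}"
  unfolding radius_measure_def
proof (subst AE_density)
  show "AE r in lborel. 0 < ennreal (\<alpha> * sinh (\<alpha> * r) / (cosh (\<alpha> * R) - 1)) * indicator {0..R} r
      \<longrightarrow> r \<in> {0..<R}"
    using AE_lborel_singleton[of R] by (rule eventually_mono) (auto simp: indicator_def)
qed simp

lemma prob_space_radius_measure: "prob_space (radius_measure \<alpha> R)"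
proof
  have "emeasure (radius_measure \<alpha> R) (space (radius_measure \<alpha> R)) = emeasure (radius_measure \<alpha> R) {..R}"
    using AE_radius_measure by (intro emeasure_eq_AE) (auto simp: radius_measure_def)
  also have "\<dots> = 1" using emeasure_radius_measure[of R] pos cosh_gt_1 by simp
  finally show "emeasure (radius_measure \<alpha> R) (space (radius_measure \<alpha> R)) = 1" .
qed

end

lemma prob_space_angle_measure: "prob_space angle_measure"
  unfolding angle_measure_def by (rule prob_space_uniform_measure) auto

lemma AE_angle_measure: "AE \<phi> in angle_measure. \<phi> \<in> circle_angles"
  unfolding angle_measure_def by (rule AE_uniform_measureI) auto

lemma measure_angle_measure:
  assumes "0 \<le> a" "a \<le> b" "b \<le> 2 * pi"
  shows "measure angle_measure {a..<b} = (b - a) / (2 * pi)"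
proof -
  have "{0..<2 * pi} \<inter> {a..<b} = {a..<b}" using assms by auto
  then show ?thesis
    unfolding angle_measure_def using assms by (subst measure_uniform_measure) auto
qed

text \<open>The mass is a quotient of terms cosh - 1, each comparable to an exponential. From x >= 4
  on, exp (\<alpha> * x) >= 4 absorbs the - 1 in the lower bound. The upper bound also covers x > R,
  as the top level may exceed R; there it is at least 1.\<close>

lemma measure_radius_bounds:
  assumes "1 / 2 < \<alpha>" "4 \<le> R"
  shows "0 \<le> x \<Longrightarrow> measure (radius_measure \<alpha> R) {..x} \<le> 2 * exp (- \<alpha> * (R - x))"
    and "4 \<le> x \<Longrightarrow> x \<le> R \<Longrightarrow> exp (- \<alpha> * (R - x)) / 2 \<le> measure (radius_measure \<alpha> R) {..x}"
proof -
  have pos: "0 < \<alpha>" "0 < R" using assms by auto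
  interpret prob_space "radius_measure \<alpha> R" by (rule prob_space_radius_measure[OF pos])
  define c where "c = cosh (\<alpha> * R) - 1"
  have c: "0 < c" using cosh_gt_1[OF pos] by (simp add: c_def)
  have big: "4 \<le> exp (\<alpha> * x)" if "4 \<le> x" for x
  proof -
    have "1 / 2 * 4 \<le> \<alpha> * x" using assms that by (intro mult_mono) auto
    then have "exp 2 \<le> exp (\<alpha> * x)" by simp
    moreover have "4 \<le> exp (2::real)" using exp_lower_Taylor_quadratic[of 2] by simp
    ultimately show ?thesis by linarith
  qed
  have m: "measure (radius_measure \<alpha> R) {..x} = (cosh (\<alpha> * x) - 1) / c" if "0 \<le> x" "x \<le> R" for x
    using emeasure_radius_measure[OF pos that] c cosh_real_ge_1[of "\<alpha> * x"]
    by (simp add: measure_def c_def)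
  have c_bounds: "exp (\<alpha> * R) / 4 \<le> c" "c \<le> exp (\<alpha> * R) / 2"
  proof -
    have "exp (- (\<alpha> * R)) \<le> 1" using pos by simp
    then show "exp (\<alpha> * R) / 4 \<le> c" "c \<le> exp (\<alpha> * R) / 2"
      using big[of R] assms exp_gt_zero[of "- (\<alpha> * R)"]
      unfolding c_def cosh_field_def add_divide_distrib by linarith+
  qed
  show "measure (radius_measure \<alpha> R) {..x} \<le> 2 * exp (- \<alpha> * (R - x))" if "0 \<le> x"
  proof (cases "x \<le> R")
    case True
    have "(cosh (\<alpha> * x) - 1) / c \<le> (exp (\<alpha> * x) / 2) / (exp (\<alpha> * R) / 4)"
    proof (rule frac_le)
      have "exp (- (\<alpha> * x)) \<le> 1" using pos that by simp
      then show "cosh (\<alpha> * x) - 1 \<le> exp (\<alpha> * x) / 2"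
        unfolding cosh_field_def add_divide_distrib by linarith
    qed (use c_bounds in auto)
    also have "\<dots> = 2 * exp (- \<alpha> * (R - x))" by (simp add: exp_diff algebra_simps)
    finally show ?thesis using m[OF that True] by simp
  next
    case False
    then have "1 \<le> exp (- \<alpha> * (R - x))" using pos by (simp add: mult_le_0_iff)
    then show ?thesis using prob_le_1[of "{..x}"] by linarith
  qed
  show "exp (- \<alpha> * (R - x)) / 2 \<le> measure (radius_measure \<alpha> R) {..x}" if "4 \<le> x" "x \<le> R"
  proof -
    have "exp (- \<alpha> * (R - x)) / 2 = (exp (\<alpha> * x) / 4) / (exp (\<alpha> * R) / 2)"
      by (simp add: exp_diff algebra_simps)
    also have "\<dots> \<le> (cosh (\<alpha> * x) - 1) / c"
    proof (rule frac_le)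
      show "exp (\<alpha> * x) / 4 \<le> cosh (\<alpha> * x) - 1"
        using big[OF that(1)] exp_gt_zero[of "- (\<alpha> * x)"]
        unfolding cosh_field_def add_divide_distrib by linarith
    next
      show "0 \<le> cosh (\<alpha> * x) - 1" using cosh_real_ge_1[of "\<alpha> * x"] by simp
    qed (use c c_bounds in auto)
    finally show ?thesis using m[of x] that by simp
  qed
qed

section \<open>Failure probability of the cell boxes\<close>

definition point_measure :: "real \<Rightarrow> real \<Rightarrow> nat \<Rightarrow> (real \<times> real) measure" where
  "point_measure \<alpha> C n = radius_measure \<alpha> (disk_radius C n) \<Otimes>\<^sub>M angle_measure"

lemma hrg_space_eq: "hrg_space \<alpha> C n = Pi\<^sub>M {..<n} (\<lambda>_. point_measure \<alpha> C n)"
  by (simp add: hrg_space_def point_measure_def)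

lemma sets_point_measure [measurable_cong]: "sets (point_measure \<alpha> C n) = sets borel"
proof -
  have "sets (point_measure \<alpha> C n) = sets ((borel :: real measure) \<Otimes>\<^sub>M (borel :: real measure))"
    unfolding point_measure_def
    by (intro sets_pair_measure_cong) (simp_all add: radius_measure_def angle_measure_def)
  then show ?thesis using borel_prod[where 'a = real and 'b = real] by metis
qed

context
  fixes \<alpha> C :: real and n :: nat
  assumes alpha: "1 / 2 < \<alpha>" and R: "4 \<le> disk_radius C n"
begin

interpretation rad: prob_space "radius_measure \<alpha> (disk_radius C n)"
  using alpha R by (intro prob_space_radius_measure) auto

interpretation ang: prob_space angle_measure
  by (rule prob_space_angle_measure)

interpretation pt: pair_prob_space "radius_measure \<alpha> (disk_radius C n)" angle_measure
  by standard

lemma prob_space_point_measure: "prob_space (point_measure \<alpha> C n)"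
  unfolding point_measure_def by (rule pt.P.prob_space_axioms)

lemma prob_space_hrg_space: "prob_space (hrg_space \<alpha> C n)"
  unfolding hrg_space_eq by (rule prob_space_PiM) (rule prob_space_point_measure)

lemma AE_point_measure:
  "AE p in point_measure \<alpha> C n. fst p \<in> {0..<disk_radius C n} \<and> snd p \<in> circle_angles"
  unfolding point_measure_def
proof (rule pt.AE_pair_measure)
  have "{0..<disk_radius C n} \<times> circle_angles \<in> sets (point_measure \<alpha> C n)"
    unfolding point_measure_def by (intro pair_measureI) (simp_all add: radius_measure_def angle_measure_def)
  moreover have "{p \<in> space (radius_measure \<alpha> (disk_radius C n) \<Otimes>\<^sub>M angle_measure).
      fst p \<in> {0..<disk_radius C n} \<and> snd p \<in> circle_angles} = {0..<disk_radius C n} \<times> circle_angles"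
    by (auto simp: space_pair_measure radius_measure_def angle_measure_def)
  ultimately show "{p \<in> space (radius_measure \<alpha> (disk_radius C n) \<Otimes>\<^sub>M angle_measure).
      fst p \<in> {0..<disk_radius C n} \<and> snd p \<in> circle_angles}
      \<in> sets (radius_measure \<alpha> (disk_radius C n) \<Otimes>\<^sub>M angle_measure)"
    by (simp add: point_measure_def)
  show "AE x in radius_measure \<alpha> (disk_radius C n). AE y in angle_measure.
      fst (x, y) \<in> {0..<disk_radius C n} \<and> snd (x, y) \<in> circle_angles"
    using AE_radius_measure[of \<alpha> "disk_radius C n"] alpha R AE_angle_measure
    by (auto elim!: eventually_mono)
qed

lemma cell_box_sets: "cell_box n l a b \<in> sets (point_measure \<alpha> C n)"
  unfolding point_measure_def cell_box_def
  by (intro pair_measureI) (simp_all add: radius_measure_def angle_measure_def)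

lemma measure_cell_box:
  assumes "a \<le> b" "b \<le> n" "0 < n"
  shows "real n * measure (point_measure \<alpha> C n) (cell_box n l a b)
    = real (b - a) * measure (radius_measure \<alpha> (disk_radius C n)) {..real l}"
proof -
  have "emeasure (point_measure \<alpha> C n) (cell_box n l a b)
      = emeasure (radius_measure \<alpha> (disk_radius C n)) {..real l}
        * emeasure angle_measure {2 * pi * real a / real n..<2 * pi * real b / real n}"
    unfolding point_measure_def cell_box_def
    by (rule ang.emeasure_pair_measure_Times) (simp_all add: radius_measure_def angle_measure_def)
  then have "measure (point_measure \<alpha> C n) (cell_box n l a b)
      = measure (radius_measure \<alpha> (disk_radius C n)) {..real l}
        * measure angle_measure {2 * pi * real a / real n..<2 * pi * real b / real n}"
    by (simp add: measure_def enn2real_mult)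
  also have "measure angle_measure {2 * pi * real a / real n..<2 * pi * real b / real n}
      = real (b - a) / real n"
    using assms by (subst measure_angle_measure) (auto simp: field_simps of_nat_diff)
  finally show ?thesis using assms by simp
qed

text \<open>The threshold 8 * ln n leaves an expected population of at least 4 * ln n, so that
  emptiness has probability at most 1 / n^4.\<close>

definition dense_cell :: "nat \<times> nat \<times> nat \<Rightarrow> bool" where
  "dense_cell = (\<lambda>(l, a, b). 4 \<le> l \<and> real l \<le> disk_radius C n \<and>
     8 * ln (real n) \<le> real (b - a) * exp (- \<alpha> * (disk_radius C n - real l)))"

definition bad_cell :: "nat \<times> nat \<times> nat \<Rightarrow> (nat \<Rightarrow> real \<times> real) set" where
  "bad_cell = (\<lambda>(l, a, b). {\<omega> \<in> space (hrg_space \<alpha> C n).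
      4 * (real (b - a) * exp (- \<alpha> * (disk_radius C n - real l)) + ln (real n))
        \<le> real (card {v \<in> {..<n}. \<omega> v \<in> cell_box n l a b}) \<or>
      dense_cell (l, a, b) \<and> (\<forall>v\<in>{..<n}. \<omega> v \<notin> cell_box n l a b)})"

lemma bad_cell_sets: "bad_cell c \<in> sets (hrg_space \<alpha> C n)"
proof -
  obtain l a b where c: "c = (l, a, b)" by (cases c)
  have pred: "Measurable.pred (hrg_space \<alpha> C n) (\<lambda>\<omega>. Q (card {v \<in> {..<n}. \<omega> v \<in> cell_box n l a b}))" for Q
    unfolding hrg_space_eq
    by (rule measurable_hits[OF prob_space_point_measure _ cell_box_sets]) simp
  have eq: "(\<forall>v\<in>{..<n}. \<omega> v \<notin> cell_box n l a b) \<longleftrightarrow> card {v \<in> {..<n}. \<omega> v \<in> cell_box n l a b} = 0" for \<omega>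
    by auto
  show ?thesis
    unfolding bad_cell_def c prod.case eq
    by (rule predE[OF pred[of "\<lambda>k. 4 * (real (b - a) * exp (- \<alpha> * (disk_radius C n - real l)) + ln (real n)) \<le> real k \<or>
      dense_cell (l, a, b) \<and> k = 0"]])
qed

text \<open>Since n * p is at most 2 * (b - a) * e, a count at the bound is at least twice the mean
  plus 4 * ln n. Both kinds of failure thus have probability at most exp (- 4 * ln n).\<close>

lemma measure_bad_cell:
  assumes "a \<le> b" "b \<le> n" "0 < n"
  shows "measure (hrg_space \<alpha> C n) (bad_cell (l, a, b)) \<le> 2 / real n ^ 4"
proof -
  interpret prob_space "hrg_space \<alpha> C n" by (rule prob_space_hrg_space)
  define p where "p = measure (point_measure \<alpha> C n) (cell_box n l a b)"
  define e where "e = exp (- \<alpha> * (disk_radius C n - real l))"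
  have np: "real n * p = real (b - a) * measure (radius_measure \<alpha> (disk_radius C n)) {..real l}"
    unfolding p_def by (rule measure_cell_box[OF assms])
  have "real n * p \<le> real (b - a) * (2 * e)"
    unfolding np e_def using measure_radius_bounds(1)[OF alpha R] by (intro mult_left_mono) auto
  then have upper: "2 * (real n * p) + 4 * ln (real n) \<le> 4 * (real (b - a) * e + ln (real n))"
    by (simp add: algebra_simps)
  have tail: "exp (- (4 * ln (real n))) = 1 / real n ^ 4"
    using assms exp_of_nat_mult[of 4 "ln (real n)"] by (simp add: exp_minus divide_inverse)
  define B1 where "B1 = {\<omega> \<in> space (hrg_space \<alpha> C n).
      2 * (real (card {..<n}) * p) + 4 * ln (real n) \<le> real (card {v \<in> {..<n}. \<omega> v \<in> cell_box n l a b})}"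
  define B2 where "B2 = {\<omega> \<in> space (hrg_space \<alpha> C n). \<forall>v\<in>{..<n}. \<omega> v \<notin> cell_box n l a b}"
  have pred: "Measurable.pred (hrg_space \<alpha> C n) (\<lambda>\<omega>. Q (card {v \<in> {..<n}. \<omega> v \<in> cell_box n l a b}))" for Q
    unfolding hrg_space_eq
    by (rule measurable_hits[OF prob_space_point_measure _ cell_box_sets]) simp
  have B1_sets: "B1 \<in> events"
    unfolding B1_def by (rule predE[OF pred[of "\<lambda>k. 2 * (real (card {..<n}) * p) + 4 * ln (real n) \<le> real k"]])
  have B2_eq: "B2 = {\<omega> \<in> space (hrg_space \<alpha> C n). card {v \<in> {..<n}. \<omega> v \<in> cell_box n l a b} = 0}"
    by (auto simp: B2_def)
  have B2_sets: "B2 \<in> events"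
    unfolding B2_eq by (rule predE[OF pred[of "\<lambda>k. k = 0"]])
  have B1: "prob B1 \<le> 1 / real n ^ 4"
    unfolding tail[symmetric] B1_def p_def unfolding hrg_space_eq
    by (rule prob_many_hits[OF prob_space_point_measure _ cell_box_sets]) simp
  have B2: "prob B2 \<le> exp (- (real n * p))"
    using prob_no_hit[OF prob_space_point_measure[of] _ cell_box_sets, of "{..<n}" l a b]
    unfolding B2_def p_def hrg_space_eq by simp
  have sub: "\<omega> \<in> B1 \<or> dense_cell (l, a, b) \<and> \<omega> \<in> B2" if "\<omega> \<in> bad_cell (l, a, b)" for \<omega>
  proof -
    have sp: "\<omega> \<in> space (hrg_space \<alpha> C n)"
      and d: "4 * (real (b - a) * e + ln (real n)) \<le> real (card {v \<in> {..<n}. \<omega> v \<in> cell_box n l a b}) \<or>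
        dense_cell (l, a, b) \<and> (\<forall>v\<in>{..<n}. \<omega> v \<notin> cell_box n l a b)"
      using that unfolding bad_cell_def e_def prod.case mem_Collect_eq by blast+
    from d show ?thesis
    proof
      assume "4 * (real (b - a) * e + ln (real n)) \<le> real (card {v \<in> {..<n}. \<omega> v \<in> cell_box n l a b})"
      from order_trans[OF upper this] sp show ?thesis
        unfolding B1_def mem_Collect_eq card_lessThan by blast
    qed (use sp in \<open>auto simp: B2_def\<close>)
  qed
  show ?thesis
  proof (cases "dense_cell (l, a, b)")
    case True
    then have l: "4 \<le> real l" "real l \<le> disk_radius C n" and d: "8 * ln (real n) \<le> real (b - a) * e"
      by (auto simp: dense_cell_def e_def)
    have "real (b - a) * (e / 2) \<le> real n * p"
      unfolding np e_def using measure_radius_bounds(2)[OF alpha R l] by (intro mult_left_mono) auto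
    with d have "- (real n * p) \<le> - (4 * ln (real n))" by simp
    then have "exp (- (real n * p)) \<le> 1 / real n ^ 4" unfolding tail[symmetric] by simp
    with B2 have B2': "prob B2 \<le> 1 / real n ^ 4" by linarith
    have "bad_cell (l, a, b) \<subseteq> B1 \<union> B2" using sub by auto
    then have "prob (bad_cell (l, a, b)) \<le> prob (B1 \<union> B2)"
      using B1_sets B2_sets by (intro finite_measure_mono) auto
    also have "\<dots> \<le> prob B1 + prob B2"
      using B1_sets B2_sets by (rule measure_Un_le)
    finally show ?thesis using B1 B2' by simp
  next
    case False
    then have "bad_cell (l, a, b) \<subseteq> B1" using sub by auto
    then have "prob (bad_cell (l, a, b)) \<le> prob B1"
      using B1_sets by (intro finite_measure_mono) auto
    moreover have "0 \<le> 1 / real n ^ 4" by simp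
    ultimately show ?thesis using B1 by linarith
  qed
qed

text \<open>At most n * (2 * n)^2 boxes fail with probability at most 2 / n^4 each. Coordinates are
  in range only almost surely, so the complement of T lies in the union of bad cells up to a null
  set.\<close>

lemma prob_good_cells:
  assumes "nat \<lceil>disk_radius C n\<rceil> + 1 \<le> n" "T \<in> sets (hrg_space \<alpha> C n)"
    and good: "\<And>\<omega>. \<omega> \<in> space (hrg_space \<alpha> C n) \<Longrightarrow>
      (\<And>v. v < n \<Longrightarrow> fst (\<omega> v) \<in> {0..<disk_radius C n}) \<Longrightarrow>
      (\<And>v. v < n \<Longrightarrow> snd (\<omega> v) \<in> circle_angles) \<Longrightarrow>
      (\<And>l a b. l \<le> nat \<lceil>disk_radius C n\<rceil> \<Longrightarrow> a \<le> b \<Longrightarrow> b \<le> n \<Longrightarrow> \<omega> \<notin> bad_cell (l, a, b)) \<Longrightarrow> \<omega> \<in> T"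
  shows "1 - measure (hrg_space \<alpha> C n) T \<le> 8 / real n"
proof -
  interpret prob_space "hrg_space \<alpha> C n" by (rule prob_space_hrg_space)
  have n: "0 < n" using assms(1) by simp
  define N where "N = nat \<lceil>disk_radius C n\<rceil>"
  define I where "I = {(l, a, b). l \<le> N \<and> a \<le> b \<and> b \<le> n}"
  have I_sub: "I \<subseteq> {..N} \<times> {..n} \<times> {..n}" by (auto simp: I_def)
  then have fin: "finite I" by (rule finite_subset) simp
  have "card I \<le> card ({..N} \<times> {..n} \<times> {..n})" using I_sub by (intro card_mono) auto
  also have "\<dots> = (N + 1) * ((n + 1) * (n + 1))" by (simp add: card_cartesian_product)
  also have "\<dots> \<le> n * ((2 * n) * (2 * n))"
    using assms(1) n by (intro mult_le_mono) (auto simp: N_def)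
  finally have cardI: "real (card I) \<le> 4 * real n ^ 3"
    using of_nat_mono[of "card I" "n * ((2 * n) * (2 * n))", where 'a = real]
    by (simp add: power3_eq_cube)
  have "AE \<omega> in hrg_space \<alpha> C n. \<forall>v\<in>{..<n}. fst (\<omega> v) \<in> {0..<disk_radius C n} \<and> snd (\<omega> v) \<in> circle_angles"
  proof (rule AE_ball_countable[THEN iffD2], simp, rule ballI)
    fix v assume v: "v \<in> {..<n}"
    show "AE \<omega> in hrg_space \<alpha> C n. fst (\<omega> v) \<in> {0..<disk_radius C n} \<and> snd (\<omega> v) \<in> circle_angles"
      unfolding hrg_space_eq
      by (rule AE_PiM_component[OF prob_space_point_measure v AE_point_measure])
  qed
  then have "AE \<omega> in hrg_space \<alpha> C n. \<omega> \<in> space (hrg_space \<alpha> C n) - T \<longrightarrow> \<omega> \<in> (\<Union>c\<in>I. bad_cell c)"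
  proof (rule eventually_mono)
    fix \<omega> assume w: "\<forall>v\<in>{..<n}. fst (\<omega> v) \<in> {0..<disk_radius C n} \<and> snd (\<omega> v) \<in> circle_angles"
    show "\<omega> \<in> space (hrg_space \<alpha> C n) - T \<longrightarrow> \<omega> \<in> (\<Union>c\<in>I. bad_cell c)"
    proof (rule impI, rule ccontr)
      assume "\<omega> \<in> space (hrg_space \<alpha> C n) - T" and nb: "\<omega> \<notin> (\<Union>c\<in>I. bad_cell c)"
      moreover have "\<omega> \<in> T"
      proof (rule good)
        show "\<omega> \<notin> bad_cell (l, a, b)" if "l \<le> nat \<lceil>disk_radius C n\<rceil>" "a \<le> b" "b \<le> n" for l a b
          using nb that by (auto simp: I_def N_def)
      qed (use calculation w in auto)
      ultimately show False by auto
    qed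
  qed
  then have "prob (space (hrg_space \<alpha> C n) - T) \<le> prob (\<Union>c\<in>I. bad_cell c)"
    using fin bad_cell_sets by (intro finite_measure_mono_AE) auto
  also have "\<dots> \<le> (\<Sum>c\<in>I. prob (bad_cell c))"
    using fin bad_cell_sets by (intro finite_measure_subadditive_finite) auto
  also have "\<dots> \<le> (\<Sum>c\<in>I. 2 / real n ^ 4)"
    using measure_bad_cell n by (intro sum_mono) (auto simp: I_def)
  also have "\<dots> = real (card I) * (2 / real n ^ 4)" by simp
  also have "\<dots> \<le> 4 * real n ^ 3 * (2 / real n ^ 4)"
    using cardI by (intro mult_right_mono) auto
  also have "\<dots> = 8 / real n" using n by (simp add: field_simps eval_nat_numeral)
  finally show ?thesis using prob_compl[OF assms(2)] by simp
qed

section \<open>Measurability of graph properties\<close>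

lemma measurable_hyp_dist:
  "(\<lambda>x. hyp_dist (fst x) (snd x)) \<in> borel_measurable ((borel :: (real \<times> real) measure) \<Otimes>\<^sub>M borel)"
proof -
  have [measurable]: "cosh \<in> borel_measurable (borel :: real measure)" "sinh \<in> borel_measurable (borel :: real measure)"
    by (intro borel_measurable_continuous_onI continuous_intros)+
  have [measurable]: "(\<lambda>x::real. arcosh x) \<in> borel_measurable borel"
    unfolding arcosh_def by measurable
  show ?thesis unfolding hyp_dist_def angular_dist_def borel_prod[symmetric] by measurable
qed

text \<open>Only finitely many edge sets exist on n vertices, so any predicate of the graph is a
  finite union of events that prescribe every edge. The search itself never has to be shown
  measurable.\<close>

lemma hrg_edges_event:
  "{\<omega> \<in> space (hrg_space \<alpha> C n). P (hrg_edges C n \<omega>)} \<in> sets (hrg_space \<alpha> C n)"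
proof -
  define V where "V = {..<n} \<times> {..<n}"
  have edge: "{\<omega> \<in> space (hrg_space \<alpha> C n). e \<in> hrg_edges C n \<omega>} \<in> sets (hrg_space \<alpha> C n)"
    if "e \<in> V" for e
  proof -
    obtain u v where e: "e = (u, v)" "u < n" "v < n" using \<open>e \<in> V\<close> by (auto simp: V_def)
    have comp: "(\<lambda>\<omega>. \<omega> w) \<in> measurable (hrg_space \<alpha> C n) borel" if "w < n" for w
      using measurable_component_singleton[of w "{..<n}" "\<lambda>_. point_measure \<alpha> C n"] that
        measurable_cong_sets[OF refl sets_point_measure] by (auto simp: hrg_space_eq)
    have "(\<lambda>\<omega>. (\<omega> u, \<omega> v)) \<in> measurable (hrg_space \<alpha> C n) (borel \<Otimes>\<^sub>M borel)"
      using comp e by (intro measurable_Pair) auto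
    from measurable_compose[OF this measurable_hyp_dist]
    have [measurable]: "(\<lambda>\<omega>. hyp_dist (\<omega> u) (\<omega> v)) \<in> borel_measurable (hrg_space \<alpha> C n)" by simp
    have "{\<omega> \<in> space (hrg_space \<alpha> C n). u \<noteq> v \<and> hyp_dist (\<omega> u) (\<omega> v) < disk_radius C n} \<in> sets (hrg_space \<alpha> C n)"
      by measurable
    then show ?thesis using e by (simp add: hrg_edges_def)
  qed
  have "{\<omega> \<in> space (hrg_space \<alpha> C n). P (hrg_edges C n \<omega>)}
      = (\<Union>E\<in>{E. E \<subseteq> V \<and> P E}. {\<omega> \<in> space (hrg_space \<alpha> C n). \<forall>e\<in>V. e \<in> hrg_edges C n \<omega> \<longleftrightarrow> e \<in> E})"
  proof -
    have sub: "hrg_edges C n \<omega> \<subseteq> V" for \<omega> by (auto simp: hrg_edges_def V_def)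
    then have "(\<forall>e\<in>V. e \<in> hrg_edges C n \<omega> \<longleftrightarrow> e \<in> E) \<longleftrightarrow> E = hrg_edges C n \<omega>" if "E \<subseteq> V" for E \<omega>
      using that by blast
    then show ?thesis using sub by auto
  qed
  also have "\<dots> \<in> sets (hrg_space \<alpha> C n)"
  proof (rule sets.finite_UN)
    have "finite V" by (simp add: V_def)
    then show "finite {E. E \<subseteq> V \<and> P E}" by simp
    fix E
    show "{\<omega> \<in> space (hrg_space \<alpha> C n). \<forall>e\<in>V. e \<in> hrg_edges C n \<omega> \<longleftrightarrow> e \<in> E} \<in> sets (hrg_space \<alpha> C n)"
    proof (rule sets.sets_Collect_finite_All[OF _ \<open>finite V\<close>])
      fix e assume "e \<in> V"
      have "{\<omega> \<in> space (hrg_space \<alpha> C n). e \<in> hrg_edges C n \<omega> \<longleftrightarrow> e \<in> E}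
        = (if e \<in> E then {\<omega> \<in> space (hrg_space \<alpha> C n). e \<in> hrg_edges C n \<omega>}
           else space (hrg_space \<alpha> C n) - {\<omega> \<in> space (hrg_space \<alpha> C n). e \<in> hrg_edges C n \<omega>})"
        by auto
      also have "\<dots> \<in> sets (hrg_space \<alpha> C n)" using edge[OF \<open>e \<in> V\<close>] by auto
      finally show "{\<omega> \<in> space (hrg_space \<alpha> C n). e \<in> hrg_edges C n \<omega> \<longleftrightarrow> e \<in> E} \<in> sets (hrg_space \<alpha> C n)" .
    qed
  qed
  finally show ?thesis .
qed

end

section \<open>Asymptotics\<close>

context good_outcome
begin

text \<open>Depends on C alone, so it can be fixed before n and the outcome.\<close>

definition overhead :: real where
  "overhead = 3000 * (110 + 60000 * Kd * (17000 * 576 * exp (C / 2) + 1))"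

text \<open>The assumptions on l0 place n * exp (- \<alpha> * \<rho>) between 8 * L and 24 * L. The
  upper end bounds exp (- \<rho>), the lower end bounds exp (\<rho> / 2).\<close>

lemma inner_radius_bounds:
  shows "real n * exp ((R - 2 * \<rho>) / 2) \<le> 576 * exp (C / 2) * L\<^sup>2 * real n powr (2 - 1 / \<alpha>)"
    and "exp (\<rho> / 2) \<le> real n powr (1 / (2 * \<alpha>))"
proof -
  have n: "0 < real n" using n_pos by simp
  have expR: "exp (R / 2) = real n * exp (C / 2)"
    using n by (simp add: disk_radius_def add_divide_distrib exp_add)
  have "exp (- \<rho>) = exp (- \<alpha> * \<rho>) powr (1 / \<alpha>)"
    using alpha by (simp add: powr_def)
  also have "\<dots> \<le> (24 * L / real n) powr (1 / \<alpha>)"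
  proof (rule powr_mono2)
    show "exp (- \<alpha> * \<rho>) \<le> 24 * L / real n" using l0(6) n by (simp add: field_simps)
  qed (use alpha in auto)
  also have "\<dots> = (24 * L) powr (1 / \<alpha>) * real n powr (- (1 / \<alpha>))"
    using n L_ge by (simp add: powr_divide powr_minus_divide)
  \<comment> \<open>Only the logarithmic factor is relaxed, by 1 / \<alpha> < 2; the exponent of n
    stays exact.\<close>
  also have "\<dots> \<le> (24 * L) powr 2 * real n powr (- (1 / \<alpha>))"
    using alpha L_ge by (intro mult_right_mono powr_mono) (auto simp: field_simps)
  also have "(24 * L) powr 2 = 576 * L\<^sup>2" using L_ge by (simp add: power_mult_distrib)
  finally have rho: "exp (- \<rho>) \<le> 576 * L\<^sup>2 * real n powr (- (1 / \<alpha>))" .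
  have "real n * exp ((R - 2 * \<rho>) / 2) = real n * (exp (R / 2) * exp (- \<rho>))"
    by (simp add: diff_divide_distrib flip: exp_add)
  also have "\<dots> \<le> real n * (real n * exp (C / 2) * (576 * L\<^sup>2 * real n powr (- (1 / \<alpha>))))"
    unfolding expR by (intro mult_left_mono rho) auto
  also have "\<dots> = 576 * exp (C / 2) * L\<^sup>2 * (real n powr 2 * real n powr (- (1 / \<alpha>)))"
    using n by (simp add: power2_eq_square)
  also have "real n powr 2 * real n powr (- (1 / \<alpha>)) = real n powr (2 - 1 / \<alpha>)"
    unfolding powr_add[symmetric] by simp
  finally show "real n * exp ((R - 2 * \<rho>) / 2) \<le> 576 * exp (C / 2) * L\<^sup>2 * real n powr (2 - 1 / \<alpha>)" .
  have "1 \<le> real n * exp (- \<alpha> * \<rho>)" using l0(5) L_ge by linarith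
  moreover have "exp (- \<alpha> * \<rho>) = 1 / exp (\<alpha> * \<rho>)" by (simp add: exp_minus divide_inverse)
  ultimately have "1 \<le> real n * (1 / exp (\<alpha> * \<rho>))" by (simp only:)
  then have "exp (\<alpha> * \<rho>) \<le> real n" by (simp add: field_simps)
  then have "\<alpha> * \<rho> \<le> ln (real n)" using n by (simp add: ln_ge_iff)
  then have "\<rho> / 2 \<le> 1 / (2 * \<alpha>) * ln (real n)" using alpha by (simp add: field_simps)
  then show "exp (\<rho> / 2) \<le> real n powr (1 / (2 * \<alpha>))" using n by (simp add: powr_def)
qed

text \<open>All polylogarithmic factors of one step are raised to \<open>L ^ 6 * \<Gamma>\<close>;
  the number of steps contributes another L * \<Gamma>.\<close>

lemma total_cost:
  "real (2 * depth + 1) * cost_bound \<le> overhead * L ^ 7 * \<Gamma>\<^sup>2 *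
     (real n powr (2 - 1 / \<alpha>) + real n powr (1 / (2 * \<alpha>)) + real (max_degree {..<n} E))"
proof -
  define P where "P = real n powr (2 - 1 / \<alpha>)"
  define Q where "Q = real n powr (1 / (2 * \<alpha>))"
  define d where "d = real (max_degree {..<n} E)"
  have pos: "0 \<le> P" "0 \<le> Q" "0 \<le> d" "0 < Kd" "1 \<le> L" "1 \<le> \<Gamma>"
    using Kd_pos L_ge Gamma_ge by (auto simp: P_def Q_def d_def)
  have LG: "1 \<le> L * \<Gamma>" using mult_mono[of 1 L 1 \<Gamma>] pos by simp
  have depth: "real depth \<le> 1000 * (L * \<Gamma>)"
    unfolding depth_def using LG by (simp add: mult.assoc)
  then have steps: "real (2 * depth + 1) \<le> 3000 * (L * \<Gamma>)" using LG by simp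
  have "real n * real depth * (17 * exp ((R - 2 * \<rho>) / 2)) = 17 * real depth * (real n * exp ((R - 2 * \<rho>) / 2))"
    by simp
  also have "\<dots> \<le> 17 * (1000 * (L * \<Gamma>)) * (576 * exp (C / 2) * L\<^sup>2 * P)"
    unfolding P_def by (rule mult_mono[OF _ inner_radius_bounds(1)]) (use depth LG in auto)
  also have "\<dots> = 17000 * 576 * exp (C / 2) * (L ^ 3 * \<Gamma> * P)"
    by (simp add: power2_eq_square power3_eq_cube)
  finally have t1: "real n * real depth * (17 * exp ((R - 2 * \<rho>) / 2))
    \<le> 17000 * 576 * exp (C / 2) * (L ^ 3 * \<Gamma> * P)" .
  have t2: "L * exp (\<rho> / 2) \<le> L * Q" unfolding Q_def using inner_radius_bounds(2) pos by (intro mult_left_mono) auto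
  define S where "S = P + Q + d"
  define W where "W = L ^ 6 * \<Gamma>"
  have LW: "L ^ k \<le> W" "L ^ k * \<Gamma> \<le> W" if "k \<le> 6" for k
  proof -
    have "L ^ k \<le> L ^ 6" using that pos by (intro power_increasing) auto
    then show "L ^ k * \<Gamma> \<le> W" unfolding W_def using pos by (intro mult_right_mono) auto
    moreover have "L ^ k * 1 \<le> L ^ k * \<Gamma>" using pos by (intro mult_left_mono) auto
    ultimately show "L ^ k \<le> W" by simp
  qed
  have W0: "0 \<le> W" using pos by (simp add: W_def)
  have "cost_bound \<le> 110 * L * d + 60000 * Kd * L ^ 3 *
      (17000 * 576 * exp (C / 2) * (L ^ 3 * \<Gamma> * P) + L * Q)"
    unfolding cost_bound_def d_def[symmetric]
    using t1 t2 pos by (intro add_mono mult_left_mono) auto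
  also have "\<dots> = 110 * (L ^ 1 * d) + 60000 * Kd *
      (17000 * 576 * exp (C / 2) * (L ^ 6 * \<Gamma> * P) + L ^ 4 * Q)"
    by (simp add: algebra_simps eval_nat_numeral)
  also have "\<dots> \<le> 110 * (W * S) + 60000 * Kd * (17000 * 576 * exp (C / 2) * (W * S) + W * S)"
  proof -
    have "L ^ 1 * d \<le> W * S" using pos LW(1)[of 1] W0 by (intro mult_mono) (auto simp: S_def)
    moreover have "L ^ 6 * \<Gamma> * P \<le> W * S" using pos LW(2)[of 6] W0 by (intro mult_mono) (auto simp: S_def)
    moreover have "L ^ 4 * Q \<le> W * S" using pos LW(1)[of 4] W0 by (intro mult_mono) (auto simp: S_def)
    ultimately show ?thesis using pos by (intro add_mono mult_left_mono) auto
  qed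
  also have "\<dots> = (overhead / 3000) * (W * S)" by (simp add: overhead_def algebra_simps)
  finally have cost: "cost_bound \<le> overhead / 3000 * (W * S)" .
  have over: "0 \<le> overhead" unfolding overhead_def using pos
    by (intro mult_nonneg_nonneg add_nonneg_nonneg) auto
  have S0: "0 \<le> S" using pos by (simp add: S_def)
  have "real (2 * depth + 1) * cost_bound \<le> real (2 * depth + 1) * (overhead / 3000 * (W * S))"
    by (intro mult_left_mono cost) simp
  also have "\<dots> \<le> 3000 * (L * \<Gamma>) * (overhead / 3000 * (W * S))"
    using over W0 S0 by (intro mult_right_mono steps) auto
  also have "\<dots> = overhead * L ^ 7 * \<Gamma>\<^sup>2 * S"
    by (simp add: W_def eval_nat_numeral)
  finally show ?thesis by (simp add: S_def P_def Q_def d_def)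
qed

end

text \<open>A solves n * exp (- \<alpha> * A) = 8 * ln n and is the ideal \<rho>; X solves exp ((1 -
  \<alpha>) * X) = 400 * ln n * exp (C / 2) and is the ideal value of R - l1. A behaves like ln n /
  \<alpha>, while X is of order ln (ln n).\<close>

lemma eventually_scales:
  fixes \<alpha> C :: real
  assumes "1 / 2 < \<alpha>" "\<alpha> < 1"
  defines "A \<equiv> \<lambda>n. (ln (real n) - ln (8 * ln (real n))) / \<alpha>"
    and "X \<equiv> \<lambda>n. ln (400 * ln (real n) * exp (C / 2)) / (1 - \<alpha>)"
  shows "\<forall>\<^sub>F n in sequentially. 3 \<le> ln (real n)"
    "\<forall>\<^sub>F n in sequentially. 4 \<le> disk_radius C n"
    "\<forall>\<^sub>F n in sequentially. disk_radius C n + 2 \<le> 3 * ln (real n)"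
    "\<forall>\<^sub>F n in sequentially. 4 \<le> disk_radius C n - A n"
    "\<forall>\<^sub>F n in sequentially. disk_radius C n + 1 \<le> 2 * (A n - 1)"
    "\<forall>\<^sub>F n in sequentially. 6 \<le> A n"
    "\<forall>\<^sub>F n in sequentially. 5 \<le> disk_radius C n - X n"
    "\<forall>\<^sub>F n in sequentially. 1 \<le> 400 * ln (real n) * exp (C / 2)"
    "\<forall>\<^sub>F n in sequentially. 4 * (8 * ln (real n) * exp (1 + X n) + 2) < real n"
    "\<forall>\<^sub>F n in sequentially. disk_radius C n + 2 \<le> real n"
proof -
  have a: "0 < \<alpha>" "0 < 1 - \<alpha>" "1 / \<alpha> < 2" "1 < 1 / \<alpha>" using assms by (auto simp: field_simps)
  show "\<forall>\<^sub>F n in sequentially. 3 \<le> ln (real n)" by real_asymp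
  show "\<forall>\<^sub>F n in sequentially. 4 \<le> disk_radius C n" unfolding disk_radius_def by real_asymp
  show "\<forall>\<^sub>F n in sequentially. disk_radius C n + 2 \<le> 3 * ln (real n)" unfolding disk_radius_def by real_asymp
  \<comment> \<open>R - A has leading term \<delta> * ln n, positive because \<alpha> > 1 /
    2.\<close>
  define \<delta> where "\<delta> = 2 - 1 / \<alpha>"
  have \<delta>: "0 < \<delta>" "A = (\<lambda>n. (2 - \<delta>) * (ln (real n) - ln (8 * ln (real n))))"
    using a by (auto simp: \<delta>_def A_def)
  show "\<forall>\<^sub>F n in sequentially. 4 \<le> disk_radius C n - A n"
    unfolding disk_radius_def \<delta>(2) using \<delta>(1) by real_asymp
  \<comment> \<open>2 * A - R has leading term 2 * \<epsilon> * ln n, positive because \<alpha> <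
    1.\<close>
  define \<epsilon> where "\<epsilon> = 1 / \<alpha> - 1"
  have \<epsilon>: "0 < \<epsilon>" "A = (\<lambda>n. (1 + \<epsilon>) * (ln (real n) - ln (8 * ln (real n))))"
    using a by (auto simp: \<epsilon>_def A_def)
  show "\<forall>\<^sub>F n in sequentially. disk_radius C n + 1 \<le> 2 * (A n - 1)"
    unfolding disk_radius_def \<epsilon>(2) using \<epsilon>(1) by real_asymp
  show "\<forall>\<^sub>F n in sequentially. 6 \<le> A n"
    unfolding A_def using a by real_asymp
  show "\<forall>\<^sub>F n in sequentially. 5 \<le> disk_radius C n - X n"
    unfolding disk_radius_def X_def using a by real_asymp
  show "\<forall>\<^sub>F n in sequentially. 1 \<le> 400 * ln (real n) * exp (C / 2)" by real_asymp
  show "\<forall>\<^sub>F n in sequentially. 4 * (8 * ln (real n) * exp (1 + X n) + 2) < real n"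
    unfolding X_def using a by real_asymp
  show "\<forall>\<^sub>F n in sequentially. disk_radius C n + 2 \<le> real n"
    unfolding disk_radius_def by real_asymp
qed

lemma good_outcome_event:
  fixes \<alpha> C :: real and n :: nat and K :: real
  defines "A \<equiv> (ln (real n) - ln (8 * ln (real n))) / \<alpha>"
    and "X \<equiv> ln (400 * ln (real n) * exp (C / 2)) / (1 - \<alpha>)"
    and "m \<equiv> nat \<lceil>1 / (1 - \<alpha>)\<rceil>"
  assumes alpha: "1 / 2 < \<alpha>" "\<alpha> < 1"
    and n: "3 \<le> ln (real n)" "4 \<le> disk_radius C n" "disk_radius C n + 2 \<le> 3 * ln (real n)"
      "4 \<le> disk_radius C n - A" "disk_radius C n + 1 \<le> 2 * (A - 1)" "6 \<le> A"
      "5 \<le> disk_radius C n - X" "1 \<le> 400 * ln (real n) * exp (C / 2)"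
      "4 * (8 * ln (real n) * exp (1 + X) + 2) < real n"
    and \<omega>: "\<And>v. v < n \<Longrightarrow> fst (\<omega> v) \<in> {0..<disk_radius C n}"
      "\<And>v. v < n \<Longrightarrow> snd (\<omega> v) \<in> circle_angles"
      "\<And>l a b. l \<le> nat \<lceil>disk_radius C n\<rceil> \<Longrightarrow> a \<le> b \<Longrightarrow> b \<le> n \<Longrightarrow> \<omega> \<notin> bad_cell \<alpha> C n (l, a, b)"
      "\<omega> \<in> space (hrg_space \<alpha> C n)"
    and K: "K = good_outcome.overhead C * (3 * (400 * exp (C / 2)) ^ m)\<^sup>2"
    and st: "s < n" "t < n"
  shows "computes_shortest_path_within (greedy (hrg_edges C n \<omega>) s t) (hrg_edges C n \<omega>) s t
    (K * ln (real n) ^ (7 + 2 * m) * (real n powr (2 - 1 / \<alpha>) + real n powr (1 / (2 * \<alpha>))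
      + real (max_degree {..<n} (hrg_edges C n \<omega>))))"
proof -
  define L where "L = ln (real n)"
  define R where "R = disk_radius C n"
  \<comment> \<open>Rounding up puts \<rho> into (A - 1, A], which widens 8 * L to the range from 8
    * L to 24 * L, as exp \<alpha> <= 3.\<close>
  define l0 where "l0 = nat \<lceil>R - A\<rceil>"
  \<comment> \<open>Rounding down puts R - l1 into [X, X + 1), hence \<Gamma> = exp (1 + X).\<close>
  define l1 where "l1 = nat \<lfloor>R - X\<rfloor>"
  have n1: "1 < n"
  proof (rule ccontr)
    assume "\<not> 1 < n"
    then have "n = 0 \<or> n = 1" by auto
    with n(1) show False by auto
  qed
  then have npos: "0 < n" by simp
  have l0: "R - A \<le> real l0" "real l0 < R - A + 1"
    using n(4) unfolding l0_def R_def by linarith+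
  have l1: "real l1 \<le> R - X" "R - X < real l1 + 1"
    using n(7) unfolding l1_def R_def by linarith+
  have X0: "0 \<le> X" using n(8) alpha by (simp add: X_def)
  have expA: "exp (\<alpha> * A) = real n / (8 * L)"
    using alpha n1 n(1) by (simp add: A_def L_def exp_diff)
  have eq: "exp (- \<alpha> * (R - real l0)) = 1 / exp (\<alpha> * (R - real l0))"
    by (simp add: exp_minus divide_inverse)
  interpret good_outcome \<alpha> C L "exp (1 + X)" n l0 l1 \<omega>
  proof
    fix l a b
    assume l: "l \<le> nat \<lceil>disk_radius C n\<rceil>" "a \<le> b" "b \<le> n"
    from \<omega>(3)[OF this] \<omega>(4) have "\<not> 4 * (real (b - a) * exp (- \<alpha> * (disk_radius C n - real l)) + ln (real n))
        \<le> real (card {v \<in> {..<n}. \<omega> v \<in> cell_box n l a b})"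
      unfolding bad_cell_def[OF alpha(1) n(2)] prod.case mem_Collect_eq by blast
    then show "real (card {v \<in> {..<n}. \<omega> v \<in> cell_box n l a b})
        \<le> 4 * (real (b - a) * exp (- \<alpha> * (disk_radius C n - real l)) + L)"
      unfolding L_def by linarith
  next
    fix l a b
    assume l: "4 \<le> l" "real l \<le> disk_radius C n" "a \<le> b" "b \<le> n"
      and d: "8 * L \<le> real (b - a) * exp (- \<alpha> * (disk_radius C n - real l))"
    have "l \<le> nat \<lceil>disk_radius C n\<rceil>" using l(2) by linarith
    from \<omega>(3)[OF this l(3,4)] \<omega>(4) have "\<not> (dense_cell \<alpha> C n (l, a, b) \<and> (\<forall>v\<in>{..<n}. \<omega> v \<notin> cell_box n l a b))"
      unfolding bad_cell_def[OF alpha(1) n(2)] prod.case mem_Collect_eq by blast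
    moreover have "dense_cell \<alpha> C n (l, a, b)"
      using l d by (simp add: dense_cell_def[OF alpha(1) n(2)] L_def)
    ultimately show "\<exists>v<n. \<omega> v \<in> cell_box n l a b" by auto
  next
    show "8 * L \<le> real n * exp (- \<alpha> * (disk_radius C n - real l0))"
    proof -
      have "\<alpha> * (R - real l0) \<le> \<alpha> * A" using l0 alpha by (intro mult_left_mono) auto
      then have "exp (\<alpha> * (R - real l0)) \<le> real n / (8 * L)" using expA by (metis exp_le_cancel_iff)
      then show ?thesis using n(1) unfolding R_def[symmetric] eq by (simp add: field_simps L_def)
    qed
    show "real n * exp (- \<alpha> * (disk_radius C n - real l0)) \<le> 24 * L"
    proof -
      have "\<alpha> * A \<le> \<alpha> * (R - real l0) + 1"
        using l0 alpha mult_left_mono[of A "R - real l0 + 1" \<alpha>] by (simp add: algebra_simps)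
      then have "real n / (8 * L) \<le> exp (\<alpha> * (R - real l0)) * exp 1"
        using expA by (metis exp_add exp_le_cancel_iff)
      also have "\<dots> \<le> exp (\<alpha> * (R - real l0)) * 3" using exp_le by (intro mult_left_mono) auto
      finally show ?thesis
        using n(1) unfolding R_def[symmetric] eq by (simp add: field_simps L_def)
    qed
    show "400 * L \<le> exp (- C / 2) * exp ((1 - \<alpha>) * (disk_radius C n - real l1))"
    proof -
      have "400 * L * exp (C / 2) = exp ((1 - \<alpha>) * X)"
        using alpha n(1) by (simp add: X_def L_def)
      also have "\<dots> \<le> exp ((1 - \<alpha>) * (R - real l1))"
        using l1 alpha by (auto intro!: mult_left_mono)
      finally show ?thesis by (simp add: exp_minus field_simps R_def)
    qed
  qed (use alpha n \<omega> l0 l1 npos X0 in \<open>auto simp: L_def R_def\<close>)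
  \<comment> \<open>So \<Gamma> is polylogarithmic: m rounds its exponent 1 / (1 - \<alpha>) up to a
    natural number.\<close>
  have "exp X = (400 * L * exp (C / 2)) powr (1 / (1 - \<alpha>))"
    using n(1) by (simp add: X_def L_def powr_def)
  also have "\<dots> \<le> (400 * L * exp (C / 2)) powr real m"
    using n(8) unfolding L_def m_def by (intro powr_mono real_nat_ceiling_ge) auto
  also have "\<dots> = (400 * exp (C / 2)) ^ m * L ^ m"
    using n(1) by (simp add: powr_realpow L_def power_mult_distrib)
  finally have X_le: "exp X \<le> (400 * exp (C / 2)) ^ m * L ^ m" .
  have "exp (1 + X) \<le> 3 * exp X" using exp_le by (simp add: exp_add)
  also have "\<dots> \<le> 3 * (400 * exp (C / 2)) ^ m * L ^ m" using X_le by simp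
  finally have "(exp (1 + X))\<^sup>2 \<le> (3 * (400 * exp (C / 2)) ^ m * L ^ m)\<^sup>2" by (intro power_mono) auto
  then have G: "(exp (1 + X))\<^sup>2 \<le> (3 * (400 * exp (C / 2)) ^ m)\<^sup>2 * L ^ (2 * m)"
    by (simp add: power_mult_distrib power_mult[symmetric] mult.commute)
  have over: "0 \<le> overhead" unfolding overhead_def using Kd_pos
    by (intro mult_nonneg_nonneg add_nonneg_nonneg) auto
  have "real (2 * depth + 1) * cost_bound \<le> overhead * L ^ 7 * (exp (1 + X))\<^sup>2 *
      (real n powr (2 - 1 / \<alpha>) + real n powr (1 / (2 * \<alpha>)) + real (max_degree {..<n} E))"
    by (rule total_cost)
  also have "\<dots> \<le> overhead * L ^ 7 * ((3 * (400 * exp (C / 2)) ^ m)\<^sup>2 * L ^ (2 * m)) *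
      (real n powr (2 - 1 / \<alpha>) + real n powr (1 / (2 * \<alpha>)) + real (max_degree {..<n} E))"
    using over L_ge by (intro mult_right_mono mult_left_mono G) auto
  also have "\<dots> = K * L ^ (7 + 2 * m) *
      (real n powr (2 - 1 / \<alpha>) + real n powr (1 / (2 * \<alpha>)) + real (max_degree {..<n} E))"
    by (simp add: K power_add)
  finally have cost: "real (2 * depth + 1) * cost_bound \<le> K * L ^ (7 + 2 * m) *
      (real n powr (2 - 1 / \<alpha>) + real n powr (1 / (2 * \<alpha>)) + real (max_degree {..<n} E))" .
  show ?thesis using cheap_search[OF st cost] unfolding L_def .
qed

theorem theorem4:
  fixes \<alpha> C :: real
  assumes "1 / 2 < \<alpha>" and "\<alpha> < 1"
  shows "\<exists>(K::real) (k::nat).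
    (\<lambda>n. 1 - measure (hrg_space \<alpha> C n)
       {\<omega> \<in> space (hrg_space \<alpha> C n).
          \<forall>s<n. \<forall>t<n.
            computes_shortest_path_within (greedy (hrg_edges C n \<omega>) s t) (hrg_edges C n \<omega>) s t
              (K * ln (real n) ^ k *
                (real n powr (2 - 1 / \<alpha>) + real n powr (1 / (2 * \<alpha>))
                 + real (max_degree {..<n} (hrg_edges C n \<omega>))))})
    \<in> O(\<lambda>n. 1 / real n)"
proof -
  define m where "m = nat \<lceil>1 / (1 - \<alpha>)\<rceil>"
  define K where "K = good_outcome.overhead C * (3 * (400 * exp (C / 2)) ^ m)\<^sup>2"
  define T where "T n = {\<omega> \<in> space (hrg_space \<alpha> C n).
          \<forall>s<n. \<forall>t<n.
            computes_shortest_path_within (greedy (hrg_edges C n \<omega>) s t) (hrg_edges C n \<omega>) s t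
              (K * ln (real n) ^ (7 + 2 * m) *
                (real n powr (2 - 1 / \<alpha>) + real n powr (1 / (2 * \<alpha>))
                 + real (max_degree {..<n} (hrg_edges C n \<omega>))))}" for n
  have "(\<lambda>n. 1 - measure (hrg_space \<alpha> C n) (T n)) \<in> O(\<lambda>n. 1 / real n)"
  proof (rule bigoI[where c = 8])
    show "\<forall>\<^sub>F n in sequentially. norm (1 - measure (hrg_space \<alpha> C n) (T n)) \<le> 8 * norm (1 / real n)"
      using eventually_scales(1)[OF assms] eventually_scales(2-5)[OF assms, of C]
        eventually_scales(6)[OF assms] eventually_scales(7-10)[OF assms, of C]
    proof eventually_elim
      case (elim n)
      have "T n \<in> sets (hrg_space \<alpha> C n)"
        unfolding T_def by (rule hrg_edges_event[OF assms(1) elim(2)])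
      have "1 - measure (hrg_space \<alpha> C n) (T n) \<le> 8 / real n"
      proof (rule prob_good_cells[OF assms(1) elim(2) _ \<open>T n \<in> _\<close>])
        show "nat \<lceil>disk_radius C n\<rceil> + 1 \<le> n" using elim(2,10) by linarith
        show "\<omega> \<in> T n" if "\<omega> \<in> space (hrg_space \<alpha> C n)"
          "\<And>v. v < n \<Longrightarrow> fst (\<omega> v) \<in> {0..<disk_radius C n}"
          "\<And>v. v < n \<Longrightarrow> snd (\<omega> v) \<in> circle_angles"
          "\<And>l a b. l \<le> nat \<lceil>disk_radius C n\<rceil> \<Longrightarrow> a \<le> b \<Longrightarrow> b \<le> n \<Longrightarrow> \<omega> \<notin> bad_cell \<alpha> C n (l, a, b)" for \<omega>
          using good_outcome_event[OF assms elim(1-9) that(2-4,1) K_def[unfolded m_def]] that(1)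
          unfolding T_def m_def by blast
      qed
      \<comment> \<open>Makes the difference nonnegative, so the norm adds nothing.\<close>
      moreover have "measure (hrg_space \<alpha> C n) (T n) \<le> 1"
        using prob_space.prob_le_1[OF prob_space_hrg_space[OF assms(1) elim(2)]] .
      ultimately show ?case by simp
    qed
  qed
  then show ?thesis unfolding T_def by blast
qed

end
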